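(* The minimal co-factor set of $T_6 \cap P_{1,7}$ is $$\Lambda(6,1,7) = \{x^2 - x + 1,\ x^2 + 1,\ x^2 + 2x + 1\}.$$
   Context: A Salem number is a real algebraic integer $\beta>1$ whose other Galois conjugates all satisfy $|\alpha|\le 1$, with at least one satisfying $|\alpha|=1$. For real $\beta>1$, the greedy beta expansion $d_\beta(1)=(c_n)_{n\ge1}$ is defined by $r_0=1$, and for $n\ge 1$: $c_n=\lfloor \beta r_{n-1}\rfloor$, $r_n=\beta r_{n-1}-\lfloor \beta r_{n-1}\rfloor$. If it is eventually periodic, $\beta$ is called a Parry number, and the smallest $m\ge0$ and $p\ge1$ with $c_{n+m}=c_{n+m+p}$ for all $n\ge1$ are the preperiod length and the period length of the expansion. (By convention $p=0$ if $r_N=0$ for some $N$; this never happens for Salem numbers.) For a Salem number $\beta$ that is a Parry number with preperiod length $m$ and period length $p\geq 1$, put $P_k(x)=x^k-c_1x^{k-1}-\dots-c_k$. The companion polynomial is $R(x)=P_{m+p}(x)-P_m(x)$; it has $\beta$ as a root, so $R(x)=P(x)Q(x)$ with $P$ the minimal polynomial of $\beta$ and $Q\in\mathbb{Z}[x]$; $Q$ is the co-factor of $\beta$. $T_n$ denotes the set of all Salem numbers of degree $n$. $P_{m,p}$ denotes the set of Salem Parry numbers whose beta expansion $d_\beta(1)$ has preperiod length $m$ and period length $p$. $C_{Q(x)}$ denotes the set of all Salem (Parry) numbers whose co-factor is $Q(x)$. The minimal co-factor set $\Lambda(n,m,p)\subseteq\mathbb{Z}[x]$ of $T_n\cap P_{m,p}$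 is the minimal set (with respect to inclusion) $\Lambda$ satisfying $T_n\cap P_{m,p}=P_{m,p}\cap\bigl(\bigcup_{q(x)\in\Lambda}C_{q(x)}\bigr)$ when the members are understood as co-factors of elements of $T_n\cap P_{m,p}$; i.e. it is the set of all co-factors of elements of $T_n\cap P_{m,p}$. *)

theory Defs
  imports Complex_Main "HOL-Computational_Algebra.Polynomial"
begin

definition min_poly :: "'a::field_char_0 \<Rightarrow> rat poly" where
  "min_poly x = (THE p. lead_coeff p = 1 \<and> poly (map_poly of_rat p) x = 0 \<and>
     (\<forall>q. q \<noteq> 0 \<and> poly (map_poly of_rat q) x = 0 \<longrightarrow> degree p \<le> degree q))"

definition galois_conjugates :: "real \<Rightarrow> complex set" where
  "galois_conjugates \<beta> = {z. poly (map_poly of_rat (min_poly \<beta>)) z = 0}"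

definition salem :: "real \<Rightarrow> bool" where
  "salem \<beta> \<longleftrightarrow> algebraic_int \<beta> \<and> \<beta> > 1 \<and>
     (\<forall>z \<in> galois_conjugates \<beta> - {of_real \<beta>}. cmod z \<le> 1) \<and>
     (\<exists>z \<in> galois_conjugates \<beta> - {of_real \<beta>}. cmod z = 1)"

primrec beta_rem :: "real \<Rightarrow> nat \<Rightarrow> real" where
  "beta_rem \<beta> 0 = 1"
| "beta_rem \<beta> (Suc n) = \<beta> * beta_rem \<beta> n - of_int \<lfloor>\<beta> * beta_rem \<beta> n\<rfloor>"

text \<open>The digits are indexed from 1; the value at index 0 is never used.\<close>

definition beta_digit :: "real \<Rightarrow> nat \<Rightarrow> int" where
  "beta_digit \<beta> n = \<lfloor>\<beta> * beta_rem \<beta> (n - 1)\<rfloor>"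

definition periodic_from :: "real \<Rightarrow> nat \<Rightarrow> nat \<Rightarrow> bool" where
  "periodic_from \<beta> m p \<longleftrightarrow> p \<ge> 1 \<and> (\<forall>n\<ge>1. beta_digit \<beta> (n + m) = beta_digit \<beta> (n + m + p))"

definition parry :: "real \<Rightarrow> bool" where
  "parry \<beta> \<longleftrightarrow> \<beta> > 1 \<and> (\<exists>m p. periodic_from \<beta> m p)"

definition preperiod_length :: "real \<Rightarrow> nat" where
  "preperiod_length \<beta> = (LEAST m. \<exists>p. periodic_from \<beta> m p)"

text \<open>By convention, a finite expansion (some remainder vanishes) has period length 0.\<close>

definition period_length :: "real \<Rightarrow> nat" where
  "period_length \<beta> =
     (if \<exists>N. beta_rem \<beta> N = 0 then 0 else (LEAST p. periodic_from \<beta> (preperiod_length \<beta>) p))"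

definition trunc_poly :: "real \<Rightarrow> nat \<Rightarrow> int poly" where
  "trunc_poly \<beta> k = monom 1 k - (\<Sum>i=1..k. monom (beta_digit \<beta> i) (k - i))"

definition companion_poly :: "real \<Rightarrow> int poly" where
  "companion_poly \<beta> = trunc_poly \<beta> (preperiod_length \<beta> + period_length \<beta>)
     - trunc_poly \<beta> (preperiod_length \<beta>)"

text \<open>The integer polynomials are compared with the minimal polynomial in \<open>\<rat>[x]\<close>;
  since \<^term>\<open>min_poly \<beta>\<close> is nonzero, \<^term>\<open>q\<close> is uniquely determined by \<^term>\<open>\<beta>\<close>.\<close>

definition is_cofactor :: "real \<Rightarrow> int poly \<Rightarrow> bool" where
  "is_cofactor \<beta> q \<longleftrightarrow> salem \<beta> \<and> parry \<beta> \<and> period_length \<beta> \<ge> 1 \<and>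
     map_poly of_int (companion_poly \<beta>) = min_poly \<beta> * map_poly of_int q"

definition salem_numbers :: "nat \<Rightarrow> real set" where
  "salem_numbers n = {\<beta>. salem \<beta> \<and> degree (min_poly \<beta>) = n}"

definition salem_parry_numbers :: "nat \<Rightarrow> nat \<Rightarrow> real set" where
  "salem_parry_numbers m p =
     {\<beta>. salem \<beta> \<and> parry \<beta> \<and> preperiod_length \<beta> = m \<and> period_length \<beta> = p}"

definition cofactor_class :: "int poly \<Rightarrow> real set" where
  "cofactor_class q = {\<beta>. is_cofactor \<beta> q}"

definition cofactor_cover :: "nat \<Rightarrow> nat \<Rightarrow> nat \<Rightarrow> int poly set \<Rightarrow> bool" where
  "cofactor_cover n m p L \<longleftrightarrow>
     salem_numbers n \<inter> salem_parry_numbers m p =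
     salem_parry_numbers m p \<inter> (\<Union>q\<in>L. cofactor_class q)"

text \<open>For \<open>p \<ge> 1\<close> the minimal cover is unique, namely the set of all co-factors of elements of
  \<^term>\<open>salem_numbers n \<inter> salem_parry_numbers m p\<close>: every cover contains all these co-factors, and
  they form a cover because a co-factor has degree \<open>m + p - n\<close>.\<close>

definition minimal_cofactor_set :: "nat \<Rightarrow> nat \<Rightarrow> nat \<Rightarrow> int poly set" where
  "minimal_cofactor_set n m p =
     (THE L. cofactor_cover n m p L \<and> (\<forall>L'. cofactor_cover n m p L' \<and> L' \<subseteq> L \<longrightarrow> L' = L))"

end

theory Submission
  imports Defs
begin

text \<open>
  The minimal polynomial \<open>M = x^6 + a x^5 + b x^4 + c x^3 + b x^2 + a x + 1\<close> of a Salem number of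
  degree 6 is reciprocal and negative at 1, and the companion polynomial is negative at 1 too, so the
  co-factor \<open>Q = x^2 + u x + v\<close> satisfies \<open>Q(1) > 0\<close>. Comparing coefficients in \<open>R = M Q\<close> expresses
  the digits through \<open>a, b, c, u, v\<close>; the bounds \<open>0 \<le> c\<^sub>n \<le> c\<^sub>1\<close> together with \<open>c\<^sub>8 \<noteq> c\<^sub>1\<close> (the
  preperiod is not 0) force \<open>v = 1\<close>. Then \<open>u \<ge> -1\<close>; \<open>u = 1\<close> contradicts the vanishing of \<open>R\<close> at
  the primitive cube roots of unity, and \<open>u \<ge> 3\<close> gives \<open>R\<close> a real root below \<open>-2\<close>.
  Conversely, \<open>(a, b, c) = (-4, -2, 3), (-8, 10, -13), (0, -2, -3)\<close> realise \<open>u = 0, 2, -1\<close>. All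
  three sextics are congruent to \<open>x^6 + x^3 + 1\<close> modulo 2, hence irreducible, and their digits are
  found by interval arithmetic.
\<close>

subsection \<open>Coefficient embeddings\<close>

lemma map_poly_hom_mult:
  fixes f :: "'a::comm_semiring_0 \<Rightarrow> 'b::comm_semiring_0"
  assumes "f 0 = 0" "\<And>x y. f (x + y) = f x + f y" "\<And>x y. f (x * y) = f x * f y"
  shows "map_poly f (p * q) = map_poly f p * map_poly f q"
proof (rule poly_eqI)
  fix n
  have sum: "f (sum g A) = (\<Sum>i\<in>A. f (g i))" for g :: "nat \<Rightarrow> 'a" and A
    by (induction A rule: infinite_finite_induct) (auto simp: assms)
  show "coeff (map_poly f (p * q)) n = coeff (map_poly f p * map_poly f q) n"
    by (simp add: coeff_map_poly coeff_mult assms sum)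
qed

lemma map_poly_of_int_mult:
  "map_poly of_int (p * q) = (map_poly of_int p * map_poly of_int q :: 'a::comm_ring_1 poly)"
  by (rule map_poly_hom_mult) auto

lemma map_poly_of_rat_mult:
  "map_poly of_rat (p * q) = (map_poly of_rat p * map_poly of_rat q :: 'a::field_char_0 poly)"
  by (rule map_poly_hom_mult) (auto simp: of_rat_add of_rat_mult)

lemma map_poly_of_rat_add:
  "map_poly of_rat (p + q) = (map_poly of_rat p + map_poly of_rat q :: 'a::field_char_0 poly)"
  by (rule poly_eqI) (simp add: coeff_map_poly of_rat_add)

lemma map_poly_of_rat_of_int:
  "map_poly of_rat (map_poly of_int p) = (map_poly of_int p :: 'a::field_char_0 poly)"
  by (simp add: map_poly_map_poly o_def)

lemma map_poly_of_int_eq_iff: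
  "map_poly of_int p = (map_poly of_int q :: 'a::ring_char_0 poly) \<longleftrightarrow> p = q"
  by (simp add: poly_eq_iff coeff_map_poly)

lemma lead_coeff_map_of_int [simp]:
  "lead_coeff (map_poly of_int p :: 'a::ring_char_0 poly) = of_int (lead_coeff p)"
  by (simp add: coeff_map_poly degree_map_poly)

lemma poly_eq_Poly_coeffs: "degree p < n \<Longrightarrow> p = Poly (map (coeff p) [0..<n])"
  by (rule poly_eqI) (auto simp: nth_default_def coeff_eq_0)

lemma poly_map_of_real:
  "poly (map_poly of_rat p) (complex_of_real x) = of_real (poly (map_poly of_rat p) x)"
proof -
  have "complex_of_real (real_of_rat q) = of_rat q" for q
    by (cases q) (simp add: of_rat_rat)
  then show ?thesis
    by (simp add: poly_altdef coeff_map_poly degree_map_poly)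
qed

lemma poly_map_of_rat_cnj:
  "poly (map_poly of_rat p) (cnj z) = cnj (poly (map_poly of_rat p) z)"
proof -
  have "cnj (of_rat q) = of_rat q" for q
    by (cases q) (simp add: of_rat_rat)
  then show ?thesis
    by (simp add: poly_altdef coeff_map_poly degree_map_poly)
qed

lemma map_poly_reflect_of_rat:
  "map_poly of_rat (reflect_poly p) = (reflect_poly (map_poly of_rat p) :: 'a::field_char_0 poly)"
  by (rule poly_eqI) (auto simp: coeff_map_poly coeff_reflect_poly degree_map_poly)

subsection \<open>Minimal polynomials\<close>

text \<open>The predicate under the \<open>THE\<close> in \<open>min_poly\<close>, kept separate so
  that one rational polynomial can be shown minimal for points of different fields, such as the real
  \<open>b\<close> and its complex conjugates.\<close>

definition is_min_poly :: "'a::field_char_0 \<Rightarrow> rat poly \<Rightarrow> bool" where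
  "is_min_poly x p \<longleftrightarrow> lead_coeff p = 1 \<and> poly (map_poly of_rat p) x = 0 \<and>
     (\<forall>q. q \<noteq> 0 \<and> poly (map_poly of_rat q) x = 0 \<longrightarrow> degree p \<le> degree q)"

lemma is_min_poly_dvd:
  assumes "is_min_poly x p" "poly (map_poly of_rat q) x = 0"
  shows "p dvd q"
proof -
  have p: "lead_coeff p = 1" "poly (map_poly of_rat p) x = 0" "p \<noteq> 0"
    using assms(1) unfolding is_min_poly_def by auto
  have "q = p * (q div p) + q mod p" by simp
  then have "poly (map_poly of_rat (p * (q div p) + q mod p)) x = 0" using assms(2) by simp
  moreover have "map_poly of_rat (p * (q div p) + q mod p) =
      (map_poly of_rat p * map_poly of_rat (q div p) + map_poly of_rat (q mod p) :: 'a poly)"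
    unfolding map_poly_of_rat_mult[symmetric] by (rule map_poly_of_rat_add)
  ultimately have "poly (map_poly of_rat (q mod p)) x = 0" using p by simp
  then have "q mod p = 0"
    using assms(1) degree_mod_less[OF p(3), of q] unfolding is_min_poly_def
    by (metis linorder_not_less)
  then show ?thesis by auto
qed

lemma monic_dvd_antisym:
  fixes p q :: "'a::field poly"
  assumes "p dvd q" "degree q \<le> degree p" "lead_coeff p = 1" "lead_coeff q = 1"
  shows "p = q"
proof -
  obtain k where k: "q = p * k" using assms(1) by blast
  have "k \<noteq> 0" "p \<noteq> 0" using assms k by auto
  then have "degree k = 0" using k assms(2) by (simp add: degree_mult_eq)
  then obtain c where c: "k = [:c:]" by (rule degree_eq_zeroE)
  show ?thesis using k c assms by (simp split: if_splits)
qed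

lemma is_min_poly_unique:
  assumes "is_min_poly x p" "is_min_poly x q"
  shows "p = q"
proof (rule monic_dvd_antisym)
  show "p dvd q" using is_min_poly_dvd[OF assms(1)] assms(2) by (simp add: is_min_poly_def)
  have "p \<noteq> 0" "q \<noteq> 0" using assms by (auto simp: is_min_poly_def)
  then show "degree q \<le> degree p" "lead_coeff p = 1" "lead_coeff q = 1"
    using assms by (simp_all add: is_min_poly_def)
qed

lemma min_poly_eqI: "is_min_poly x p \<Longrightarrow> min_poly x = p"
  unfolding min_poly_def is_min_poly_def[symmetric]
  by (blast intro: is_min_poly_unique)

lemma is_min_poly_min_poly:
  fixes x :: "'a::field_char_0"
  assumes "q \<noteq> 0" "poly (map_poly of_rat q) x = 0"
  shows "is_min_poly x (min_poly x)"
proof -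
  define P where "P = (\<lambda>q. q \<noteq> 0 \<and> poly (map_poly of_rat q) x = 0)"
  obtain p where p: "P p" "\<And>q. P q \<Longrightarrow> degree p \<le> degree q"
    using ex_has_least_nat[of P q degree] assms unfolding P_def by blast
  define p' where "p' = smult (inverse (lead_coeff p)) p"
  have l: "lead_coeff p' = 1" "degree p' = degree p"
    using p unfolding p'_def P_def by (simp_all)
  have "map_poly of_rat p' = smult (of_rat (inverse (lead_coeff p))) (map_poly of_rat p :: 'a poly)"
    unfolding p'_def by (rule poly_eqI) (simp add: coeff_map_poly of_rat_mult)
  then have "poly (map_poly of_rat p') x = 0" using p by (simp add: P_def)
  then have "is_min_poly x p'"
    using l p(2) unfolding is_min_poly_def P_def by metis
  then show ?thesis using min_poly_eqI by metis
qed

text \<open>Irreducibility in disguise. The minimal polynomial \<open>n\<close> of \<open>z\<close>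
  divides \<open>m\<close>, say \<open>m = n * k\<close>, and \<open>x\<close> is a root of one
  factor. It cannot be a root of \<open>k\<close>, whose degree is below that of \<open>m\<close>;
  so it is a root of \<open>n\<close>, and \<open>n\<close> has the full degree of
  \<open>m\<close>.\<close>

lemma min_poly_conjugate:
  fixes x :: "'a::field_char_0" and z :: "'b::field_char_0"
  assumes m: "is_min_poly x (min_poly x)" and z: "poly (map_poly of_rat (min_poly x)) z = 0"
  shows "is_min_poly z (min_poly x)"
proof -
  define m n where "m = min_poly x" and "n = min_poly z"
  have m0: "m \<noteq> 0" "lead_coeff m = 1" "poly (map_poly of_rat m) x = 0"
    using m unfolding is_min_poly_def m_def by auto
  have n: "is_min_poly z n"
    unfolding n_def using m0 z is_min_poly_min_poly unfolding m_def by blast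
  then obtain k where k: "m = n * k" using is_min_poly_dvd z unfolding m_def by blast
  have n0: "n \<noteq> 0" "lead_coeff n = 1" "poly (map_poly of_rat n) z = 0" 
    using n unfolding is_min_poly_def by auto
  have k0: "k \<noteq> 0" using k m0 by auto
  have dn: "degree n \<noteq> 0"
  proof
    assume "degree n = 0"
    then obtain c where "n = [:c:]" by (rule degree_eq_zeroE)
    then show False using n0 by (simp add: map_poly_pCons)
  qed
  have deg: "degree m = degree n + degree k" using k n0 k0 by (simp add: degree_mult_eq)
  have "poly (map_poly of_rat n) x = 0 \<or> poly (map_poly of_rat k) x = 0"
    using m0(3) unfolding k map_poly_of_rat_mult by simp
  moreover have "poly (map_poly of_rat k) x \<noteq> 0"
    using m k0 deg dn unfolding is_min_poly_def m_def[symmetric] by force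
  ultimately have "degree m \<le> degree n"
    using m n0 unfolding is_min_poly_def m_def[symmetric] by blast
  then have "n = m"
    by (intro monic_dvd_antisym) (use k n0 m0 in auto)
  then show ?thesis using n m_def by simp
qed

subsection \<open>Gauss' lemma for monic polynomials\<close>

lemma rat_poly_denominator:
  fixes f :: "rat poly"
  obtains d :: int and F where "d > 0" "smult (of_int d) f = map_poly of_int F"
proof -
  have "\<exists>d>0. \<exists>F. smult (of_int d) f = map_poly of_int F"
  proof (induction f)
    case 0
    show ?case by (rule exI[of _ 1]) (auto intro: exI[of _ 0])
  next
    case (pCons a f)
    then obtain d F where d: "d > 0" "smult (of_int d) f = map_poly of_int F" by blast
    obtain n e where e: "a = Fract n e" "e > 0" by (cases a) auto
    have "smult (of_int (d * e)) (pCons a f) = map_poly of_int (pCons (d * n) (smult e F))"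
    proof -
      have "smult (of_int (d * e)) f = map_poly of_int (smult e F)"
        using d(2) by (metis (no_types, lifting) map_poly_smult mult.commute of_int_0 of_int_mult smult_smult)
      moreover have "of_int (d * e) * a = of_int (d * n)"
        using e by (simp add: Fract_of_int_quotient)
      ultimately show ?thesis by (simp add: map_poly_pCons)
    qed
    then show ?case using d e by (meson mult_pos_pos)
  qed
  then show ?thesis using that by blast
qed

text \<open>Clearing denominators by \<open>d\<close> and \<open>e\<close> gives integer polynomials
  with leading coefficients \<open>d\<close> and \<open>e\<close>, so their contents divide
  \<open>d\<close> and \<open>e\<close>. As \<open>h\<close> is monic, hence primitive, the contents
  multiply to \<open>d * e\<close>. Thus \<open>d\<close> divides all of \<open>F\<close> and can be
  cancelled.\<close>

lemma monic_rat_factors_int: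
  fixes f g :: "rat poly"
  assumes fg: "f * g = map_poly of_int h" and monic: "lead_coeff f = 1" "lead_coeff g = 1"
  shows "\<exists>F. f = map_poly of_int F"
proof -
  obtain d F where F: "d > 0" "smult (of_int d) f = map_poly of_int F" by (rule rat_poly_denominator)
  obtain e G where G: "e > 0" "smult (of_int e) g = map_poly of_int G" by (rule rat_poly_denominator)
  have lF: "lead_coeff F = d"
    using F monic lead_coeff_map_of_int[of F, where 'a=rat] by (metis lead_coeff_smult mult.right_neutral of_int_eq_iff)
  have lG: "lead_coeff G = e"
    using G monic lead_coeff_map_of_int[of G, where 'a=rat] by (metis lead_coeff_smult mult.right_neutral of_int_eq_iff)
  have "lead_coeff (f * g) = 1" using monic by (simp add: lead_coeff_mult)
  then have "lead_coeff h = 1" using fg by (metis lead_coeff_map_of_int of_int_eq_1_iff)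
  then have "content h dvd 1" by (metis content_dvd_coeff)
  then have ch: "content h = 1" by (simp only: is_unit_content_iff)
  have "map_poly of_int (F * G) = smult (of_int (d * e)) (f * g)"
    unfolding map_poly_of_int_mult F(2)[symmetric] G(2)[symmetric] by (simp add: mult.commute)
  also have "\<dots> = map_poly of_int (smult (d * e) h)"
    unfolding fg by (simp add: map_poly_smult)
  finally have "F * G = smult (d * e) h" unfolding map_poly_of_int_eq_iff .
  then have c: "content F * content G = d * e"
    using F G ch by (metis content_mult content_smult mult.right_neutral mult_pos_pos normalize_int_def abs_of_pos)
  have cF: "content F dvd d" and cG: "content G dvd e" using lF lG content_dvd_coeff by metis+
  have "d dvd content F"
  proof -
    obtain k where k: "e = content G * k" using cG by blast
    have "content G \<noteq> 0" using k G by auto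
    moreover have "content G * content F = content G * (d * k)" using c k by (simp add: mult_ac)
    ultimately show ?thesis by simp
  qed
  then have "\<forall>n. d dvd coeff F n" by (meson content_dvd_coeff dvd_trans)
  then have "[:d:] dvd F" using const_poly_dvd_iff by blast
  then obtain F' where "F = [:d:] * F'" by blast
  then have "smult (of_int d) f = smult (of_int d) (map_poly of_int F')"
    using F(2) by (simp add: map_poly_smult)
  then have "f = map_poly of_int F'" using F(1) by (simp add: poly_eq_iff)
  then show ?thesis ..
qed

subsection \<open>Minimal polynomials of Salem numbers\<close>

lemma salem_is_min_poly: 
  assumes "salem b" shows "is_min_poly b (min_poly b)"
proof -
  obtain p where "poly (map_poly of_int p) b = 0" "lead_coeff p = 1"
    using assms unfolding salem_def algebraic_int_altdef_ipoly by blast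
  then show ?thesis
    by (intro is_min_poly_min_poly[of "map_poly of_int p"])
       (auto simp: map_poly_of_rat_of_int map_poly_of_int_eq_iff[of p 0, simplified])
qed

lemma min_poly_algebraic_int:
  assumes "algebraic_int x"
  shows "\<exists>M. min_poly x = map_poly of_int M \<and> lead_coeff M = 1"
proof -
  obtain p where p: "poly (map_poly of_int p) x = 0" "lead_coeff p = 1"
    using assms unfolding algebraic_int_altdef_ipoly by blast
  have p0: "(map_poly of_int p :: rat poly) \<noteq> 0"
    using p(2) map_poly_of_int_eq_iff[of p 0, where 'a=rat] by auto
  have pr: "poly (map_poly of_rat (map_poly of_int p)) x = 0"
    using p(1) by (simp add: map_poly_of_rat_of_int)
  have m: "is_min_poly x (min_poly x)"
    using is_min_poly_min_poly[OF p0 pr] .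
  then obtain k where k: "min_poly x * k = map_poly of_int p" using is_min_poly_dvd[OF m pr] by (metis dvdE)
  have l: "lead_coeff (min_poly x) = 1" using m by (simp add: is_min_poly_def)
  have "lead_coeff (min_poly x * k) = 1" unfolding k lead_coeff_map_of_int p(2) by simp
  then have "lead_coeff k = 1" using l by (simp add: lead_coeff_mult)
  then obtain M where M: "min_poly x = map_poly of_int M" using monic_rat_factors_int[OF k l] by blast
  then have "lead_coeff M = 1" using l lead_coeff_map_of_int[of M, where 'a=rat] by simp
  then show ?thesis using M by blast
qed

text \<open>For a rational conjugate \<open>r\<close> the minimal polynomial would divide X - r, and
  its root \<open>b\<close> would equal \<open>r\<close>. This serves to exclude 0 and 1 as
  conjugates.\<close>

lemma salem_no_rational_conjugate:
  assumes "salem b" "poly (map_poly of_rat (min_poly b)) z = 0" "z = complex_of_real x" "x \<noteq> b"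
  shows "x \<notin> \<rat>"
proof
  assume "x \<in> \<rat>"
  then obtain r where r: "x = of_rat r" by (auto elim: Rats_cases)
  have m: "is_min_poly x (min_poly b)"
    using min_poly_conjugate[OF salem_is_min_poly[OF assms(1)], where z = x] assms(2,3)
    by (simp add: poly_map_of_real)
  have "min_poly b dvd [:-r, 1:]"
    by (rule is_min_poly_dvd[OF m]) (simp add: map_poly_pCons r of_rat_minus)
  then obtain k where k: "[:-r, 1:] = min_poly b * k" by blast
  have "poly (map_poly of_rat [:-r, 1:]) b = 0"
    unfolding k map_poly_of_rat_mult
    using salem_is_min_poly[OF assms(1)] by (simp add: is_min_poly_def)
  then show False using assms(4) r by (simp add: map_poly_pCons of_rat_minus)
qed

lemma salem_no_real_root_ge_1:
  assumes "salem b" "x \<ge> 1" "poly (map_poly of_rat (min_poly b)) x = 0"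
  shows "x = b"
proof (rule ccontr)
  assume x: "x \<noteq> b"
  have z: "poly (map_poly of_rat (min_poly b)) (complex_of_real x) = 0"
    using assms by (simp add: poly_map_of_real)
  have "complex_of_real x \<in> galois_conjugates b - {of_real b}"
    using z x by (simp add: galois_conjugates_def)
  then have "cmod (complex_of_real x) \<le> 1" using assms(1) unfolding salem_def by blast
  then have "x = 1" using assms(2) by simp
  then show False using salem_no_rational_conjugate[OF assms(1) z refl x] by simp
qed

lemma salem_min_poly_root:
  "salem b \<Longrightarrow> poly (map_poly of_rat (min_poly b)) b = 0"
  using salem_is_min_poly is_min_poly_def by blast

text \<open>Split off X - b. The remaining factor \<open>s\<close> is monic without zeros on [1,
  oo), hence positive at 1, while 1 - b is negative.\<close>

lemma salem_min_poly_at_1_neg: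
  assumes "salem b"
  shows "poly (map_poly of_rat (min_poly b)) (1::real) < 0"
proof -
  define p :: "real poly" where "p = map_poly of_rat (min_poly b)"
  have m: "is_min_poly b (min_poly b)" using assms by (rule salem_is_min_poly)
  have b: "b > 1" using assms by (simp add: salem_def)
  have lp: "lead_coeff p = 1" using m by (simp add: p_def is_min_poly_def coeff_map_poly degree_map_poly)
  have pb: "poly p b = 0" using salem_min_poly_root[OF assms] by (simp add: p_def)
  then obtain s where s: "p = [:-b, 1:] * s" using poly_eq_0_iff_dvd by blast
  have ls: "lead_coeff s = 1" using lp unfolding s lead_coeff_mult by simp
  have dm: "degree (min_poly b) \<noteq> 0"
  proof
    assume "degree (min_poly b) = 0"
    then obtain c where c: "min_poly b = [:c:]" by (rule degree_eq_zeroE)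
    then show False using m by (auto simp: is_min_poly_def map_poly_pCons)
  qed
  \<comment> \<open>A double root at \<open>b\<close> would make the minimal polynomial divide its
    own derivative, which is impossible in characteristic 0.\<close>
  have "poly s b \<noteq> 0"
  proof
    assume "poly s b = 0"
    then have "poly (pderiv p) b = 0" unfolding s pderiv_mult by simp
    moreover have "pderiv p = map_poly of_rat (pderiv (min_poly b))"
      unfolding p_def by (rule poly_eqI) (simp add: coeff_pderiv coeff_map_poly of_rat_mult of_rat_add)
    ultimately have "min_poly b dvd pderiv (min_poly b)" by (intro is_min_poly_dvd[OF m]) simp
    then show False using dm by simp
  qed
  then have nz: "poly s x \<noteq> 0" if "x \<ge> 1" for x
    using salem_no_real_root_ge_1[OF assms that] s p_def by (metis mult_zero_right poly_mult)
  have "poly s 1 > 0"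
  proof (rule ccontr)
    assume "\<not> poly s 1 > 0"
    then have s1: "poly s 1 < 0" using nz[of 1] by simp
    obtain n where n: "\<And>x. x \<ge> n \<Longrightarrow> poly s x \<ge> lead_coeff s"
      using poly_pinfty_gt_lc[of s] ls by auto
    define y where "y = max n 2"
    have "poly s y > 0" using n[of y] ls by (simp add: y_def)
    moreover have "1 < y" by (simp add: y_def)
    ultimately obtain x where "1 < x" "poly s x = 0"
      using poly_IVT_pos[of 1 y s] s1 by blast
    then show False using nz[of x] by simp
  qed
  then show ?thesis using b unfolding p_def[symmetric] s by (simp add: mult_neg_pos)
qed

text \<open>A conjugate \<open>z\<close> on the unit circle satisfies 1/z = \<open>cnj z\<close>,
  again a conjugate, so \<open>z\<close> is also a root of the reflected polynomial. Since
  \<open>m\<close> is the minimal polynomial of \<open>z\<close> too, it divides its reflection,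
  which has the same degree.\<close>

lemma salem_min_poly_reciprocal:
  assumes "salem b"
  shows "reflect_poly (min_poly b) = min_poly b"
proof -
  define m where "m = min_poly b"
  have m: "is_min_poly b m" unfolding m_def using assms by (rule salem_is_min_poly)
  obtain z where z: "poly (map_poly of_rat m) z = 0" "cmod z = 1"
    using assms unfolding salem_def galois_conjugates_def m_def by blast
  have z0: "z \<noteq> 0" using z(2) by auto
  have inv: "inverse z = cnj z" using complex_norm_square[of z] z(2) by (intro inverse_unique) simp
  have "poly (map_poly of_rat (reflect_poly m)) z = 0"
    using z poly_map_of_rat_cnj[of m z] by (simp add: map_poly_reflect_of_rat poly_reflect_poly_nz[OF z0] inv)
  then have dvd: "m dvd reflect_poly m"
    using is_min_poly_dvd min_poly_conjugate m z(1) unfolding m_def by blast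
  have m1: "poly m 1 \<noteq> 0"
  proof
    assume "poly m 1 = 0"
    moreover have "poly (map_poly of_rat m) (1::real) = of_rat (poly m 1)"
      by (simp add: poly_altdef coeff_map_poly degree_map_poly of_rat_sum)
    ultimately show False using salem_min_poly_at_1_neg[OF assms] by (simp add: m_def)
  qed
  have b: "b > 1" using assms by (simp add: salem_def)
  have m0: "coeff m 0 \<noteq> 0"
  proof
    assume "coeff m 0 = 0"
    then have "poly (map_poly of_rat m) (complex_of_real 0) = 0" by (simp add: poly_0_coeff_0 coeff_map_poly)
    then show False using salem_no_rational_conjugate[OF assms, of _ 0] b unfolding m_def by force
  qed
  obtain k where k: "reflect_poly m = m * k" using dvd by blast
  have "m \<noteq> 0" using m0 by auto
  then have "k \<noteq> 0" using k by (metis mult_zero_right reflect_poly_eq_0_iff)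
  then have "degree k = 0" using degree_mult_eq[of m k] degree_reflect_poly_eq[OF m0] k \<open>m \<noteq> 0\<close> by simp
  then obtain c where c: "k = [:c:]" by (rule degree_eq_zeroE)
  \<comment> \<open>Reflection keeps the sum of the coefficients. As this sum is nonzero, the
    constant quotient is 1; in particular the sign -1 is excluded.\<close>
  have "poly (reflect_poly m) 1 = poly m 1" by (simp add: poly_reflect_poly_nz)
  then have "c = 1" using k c m1 by simp
  then show ?thesis using k c m_def by simp
qed

subsection \<open>Beta expansions\<close>

lemma beta_rem_Suc: "beta_rem b (Suc n) = b * beta_rem b n - of_int (beta_digit b (Suc n))"
  by (simp add: beta_digit_def)

lemma beta_rem_bounds: "0 \<le> beta_rem b n" "beta_rem b n \<le> 1" "n > 0 \<Longrightarrow> beta_rem b n < 1"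
  by (cases n; simp add: of_int_floor_le; linarith)+

lemma beta_digit_1: "beta_digit b (Suc 0) = \<lfloor>b\<rfloor>"
  by (simp add: beta_digit_def)

lemma beta_digit_bounds:
  assumes "b > 1" "n > 0"
  shows "0 \<le> beta_digit b n" "beta_digit b n \<le> beta_digit b 1"
proof -
  have "b * beta_rem b (n - 1) \<le> b * 1"
    by (rule mult_left_mono) (use assms beta_rem_bounds in auto)
  then show "beta_digit b n \<le> beta_digit b 1"
    unfolding beta_digit_def by (simp add: floor_mono)
  show "0 \<le> beta_digit b n"
    unfolding beta_digit_def using assms beta_rem_bounds(1)[of b "n - 1"] by simp
qed

lemma trunc_poly_0: "trunc_poly b 0 = 1"
  by (simp add: trunc_poly_def monom_0)

text \<open>The Horner step: it mirrors the recursion of \<open>beta_rem\<close>, so that evaluation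
  at \<open>b\<close> yields the remainders by induction.\<close>

lemma trunc_poly_Suc: "trunc_poly b (Suc k) = pCons (- beta_digit b (Suc k)) (trunc_poly b k)"
proof -
  have "(\<Sum>i=1..Suc k. monom (beta_digit b i) (Suc k - i)) =
      (\<Sum>i=1..k. monom (beta_digit b i) (Suc (k - i))) + [:beta_digit b (Suc k):]"
    by (simp add: monom_0 Suc_diff_le)
  also have "(\<Sum>i=1..k. monom (beta_digit b i) (Suc (k - i))) = pCons 0 (\<Sum>i=1..k. monom (beta_digit b i) (k - i))"
    by (induction k rule: nat.induct; simp only: monom_Suc) 
       (auto simp: monom_Suc poly_eq_iff coeff_pCons coeff_sum split: nat.splits)
  finally show ?thesis
    by (simp add: trunc_poly_def monom_Suc)
qed

lemma poly_trunc_poly: "poly (map_poly of_int (trunc_poly b k)) b = beta_rem b k"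
  by (induction k) (simp_all add: trunc_poly_0 trunc_poly_Suc map_poly_pCons beta_rem_Suc del: beta_rem.simps(2))

text \<open>While the digits agree, the difference of the two remainders is multiplied by
  \<open>b > 1\<close> at each step. It stays bounded by 1, so it is 0.\<close>

lemma beta_rem_eq_of_periodic:
  assumes "b > 1" "periodic_from b m p"
  shows "beta_rem b (m + p + k) = beta_rem b (m + k)"
proof -
  define d where "d n = beta_rem b (m + p + n) - beta_rem b (m + n)" for n
  have "d (Suc n) = b * d n" for n
  proof -
    have "beta_digit b (Suc n + m) = beta_digit b (Suc n + m + p)"
      using assms(2) unfolding periodic_from_def by auto
    then have "beta_digit b (Suc (m + n)) = beta_digit b (Suc (m + p + n))"
      by (simp add: ac_simps)
    then show ?thesis
      unfolding d_def add_Suc_right beta_rem_Suc by (simp add: algebra_simps)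
  qed
  then have d: "d n = b ^ n * d 0" for n by (induction n) auto
  have le: "\<bar>d n\<bar> \<le> 1" for n
    unfolding d_def using beta_rem_bounds(1,2)[of b "m + p + n"] beta_rem_bounds(1,2)[of b "m + n"] by linarith
  have "d 0 = 0"
  proof (rule ccontr)
    assume "d 0 \<noteq> 0"
    obtain n where "1 / \<bar>d 0\<bar> < b ^ n" using real_arch_pow[OF assms(1)] by blast
    then have "1 < b ^ n * \<bar>d 0\<bar>" using \<open>d 0 \<noteq> 0\<close> by (subst (asm) pos_divide_less_eq) auto
    also have "\<dots> = \<bar>d n\<bar>" using assms(1) unfolding d[of n] abs_mult by simp
    finally have "1 < \<bar>d n\<bar>" .
    then show False using le[of n] by simp
  qed
  then have "d k = 0" unfolding d[of k] by simp
  then show ?thesis by (simp add: d_def)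
qed

text \<open>A period length of at least 1 rules out the conventional value 0 for finite expansions,
  so both lengths are genuine least values.\<close>

lemma parry_periodic_from:
  assumes "parry b" "period_length b \<ge> 1"
  shows "periodic_from b (preperiod_length b) (period_length b)"
proof -
  have "\<exists>p. periodic_from b (preperiod_length b) p"
    unfolding preperiod_length_def using assms(1) unfolding parry_def by (auto intro: LeastI)
  then have "periodic_from b (preperiod_length b) (LEAST p. periodic_from b (preperiod_length b) p)"
    by (auto intro: LeastI)
  moreover have "period_length b = (LEAST p. periodic_from b (preperiod_length b) p)"
    using assms(2) unfolding period_length_def by (auto split: if_splits)
  ultimately show ?thesis by simp
qed

lemma companion_poly_root:
  assumes "parry b" "period_length b \<ge> 1"
  shows "poly (map_poly of_int (companion_poly b)) b = 0"
proof -
  have "beta_rem b (preperiod_length b + period_length b) = beta_rem b (preperiod_length b)"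
    using beta_rem_eq_of_periodic[OF _ parry_periodic_from[OF assms], of 0] assms(1)
    by (simp add: parry_def)
  moreover have "map_poly of_int (p - q) = (map_poly of_int p - map_poly of_int q :: real poly)" for p q
    by (rule poly_eqI) (simp add: coeff_map_poly)
  ultimately show ?thesis
    unfolding companion_poly_def by (simp add: poly_trunc_poly)
qed

section \<open>Companion polynomials and their co-factors\<close>

lemma degree_trunc_poly: "degree (trunc_poly b k) = k" and lead_coeff_trunc_poly: "lead_coeff (trunc_poly b k) = 1"
proof -
  have "degree (trunc_poly b k) = k \<and> lead_coeff (trunc_poly b k) = 1"
    by (induction k) (auto simp: trunc_poly_0 trunc_poly_Suc)
  then show "degree (trunc_poly b k) = k" "lead_coeff (trunc_poly b k) = 1" by auto
qed

lemma companion_poly_monic: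
  assumes "period_length b \<ge> 1"
  shows "degree (companion_poly b) = preperiod_length b + period_length b"
    "lead_coeff (companion_poly b) = 1"
proof -
  let ?k = "preperiod_length b + period_length b"
  have lt: "degree (- trunc_poly b (preperiod_length b)) < degree (trunc_poly b ?k)"
    using assms by (simp add: degree_trunc_poly)
  show "degree (companion_poly b) = ?k"
    using degree_add_eq_left[OF lt] unfolding companion_poly_def by (simp add: degree_trunc_poly)
  show "lead_coeff (companion_poly b) = 1"
    using lead_coeff_trunc_poly[of b ?k] lt unfolding \<open>degree (companion_poly b) = ?k\<close>
    by (simp add: companion_poly_def degree_trunc_poly coeff_eq_0)
qed

lemma is_cofactor_unique:
  assumes "is_cofactor b p" "is_cofactor b q"
  shows "p = q"
proof -
  have "salem b" using assms(1) by (simp add: is_cofactor_def)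
  then have "min_poly b \<noteq> 0" using salem_is_min_poly[of b] by (auto simp: is_min_poly_def)
  moreover have "min_poly b * map_poly of_int p = min_poly b * map_poly of_int q"
    using assms by (simp add: is_cofactor_def)
  ultimately show ?thesis by (simp add: map_poly_of_int_eq_iff)
qed

lemma degree_is_cofactor:
  assumes "is_cofactor b q"
  shows "degree (min_poly b) + degree q = preperiod_length b + period_length b"
proof -
  have eq: "map_poly of_int (companion_poly b) = min_poly b * map_poly of_int q" and "period_length b \<ge> 1"
    using assms by (simp_all add: is_cofactor_def)
  have R: "companion_poly b \<noteq> 0" using companion_poly_monic[OF \<open>period_length b \<ge> 1\<close>] by auto
  then have "map_poly of_int (companion_poly b) \<noteq> (0 :: rat poly)"
    using map_poly_of_int_eq_iff[of "companion_poly b" 0, where 'a=rat] by simp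
  then have "degree (min_poly b * map_poly of_int q) = degree (min_poly b) + degree q"
    unfolding eq by (subst degree_mult_eq) (auto simp: degree_map_poly)
  then show ?thesis
    using companion_poly_monic[OF \<open>period_length b \<ge> 1\<close>] eq
    by (metis degree_map_poly of_int_eq_0_iff)
qed

lemma is_cofactor_exists:
  assumes "salem b" "parry b" "period_length b \<ge> 1"
  shows "\<exists>q. is_cofactor b q"
proof -
  let ?R = "map_poly of_int (companion_poly b) :: rat poly"
  have m: "is_min_poly b (min_poly b)" using assms(1) by (rule salem_is_min_poly)
  have l: "lead_coeff (min_poly b) = 1" using m by (simp add: is_min_poly_def)
  have "min_poly b dvd ?R"
    by (rule is_min_poly_dvd[OF m]) (use companion_poly_root[OF assms(2,3)] in \<open>simp add: map_poly_of_rat_of_int\<close>)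
  then obtain k where k: "?R = min_poly b * k" by blast
  have "lead_coeff ?R = 1" 
    using companion_poly_monic(2)[OF assms(3)] by (simp only: lead_coeff_map_of_int of_int_1)
  then have "lead_coeff k = 1" unfolding k lead_coeff_mult l by simp
  then obtain q where "k = map_poly of_int q"
    using monic_rat_factors_int[of k "min_poly b" "companion_poly b"] k l by (auto simp: mult.commute)
  then show ?thesis using k assms by (auto simp: is_cofactor_def)
qed

text \<open>The degree condition forces a Salem Parry number with co-factor in \<open>L\<close> to
  have degree \<open>n\<close>, so \<open>L\<close> is a cover. A witness has only one co-factor, so
  every cover must contain it; hence \<open>L\<close> is the least cover and the only minimal
  one.\<close>

lemma minimal_cofactor_setI:
  assumes cofactors: "\<And>b q. b \<in> salem_numbers n \<inter> salem_parry_numbers m p \<Longrightarrow> is_cofactor b q \<Longrightarrow> q \<in> L"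
    and witness: "\<And>q. q \<in> L \<Longrightarrow> \<exists>b \<in> salem_numbers n \<inter> salem_parry_numbers m p. is_cofactor b q"
    and p: "p \<ge> 1" and deg: "\<And>q. q \<in> L \<Longrightarrow> n + degree q = m + p"
  shows "minimal_cofactor_set n m p = L"
proof -
  have cover: "cofactor_cover n m p L"
    unfolding cofactor_cover_def
  proof (intro equalityI subsetI)
    fix b assume b: "b \<in> salem_numbers n \<inter> salem_parry_numbers m p"
    then obtain q where q: "is_cofactor b q"
      using is_cofactor_exists[of b] p by (auto simp: salem_parry_numbers_def)
    then show "b \<in> salem_parry_numbers m p \<inter> (\<Union>q\<in>L. cofactor_class q)"
      using b cofactors[OF b q] by (auto simp: cofactor_class_def)
  next
    fix b assume "b \<in> salem_parry_numbers m p \<inter> (\<Union>q\<in>L. cofactor_class q)"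
    then obtain q where b: "b \<in> salem_parry_numbers m p" and q: "q \<in> L" "is_cofactor b q"
      by (auto simp: cofactor_class_def)
    then show "b \<in> salem_numbers n \<inter> salem_parry_numbers m p"
      using degree_is_cofactor[OF q(2)] deg[OF q(1)]
      by (auto simp: salem_numbers_def salem_parry_numbers_def)
  qed
  have least: "L \<subseteq> L'" if L': "cofactor_cover n m p L'" for L'
  proof
    fix q assume "q \<in> L"
    then obtain b where b: "b \<in> salem_numbers n \<inter> salem_parry_numbers m p" "is_cofactor b q"
      using witness by blast
    then obtain q' where "q' \<in> L'" "is_cofactor b q'"
      using L' unfolding cofactor_cover_def cofactor_class_def by blast
    then show "q \<in> L'" using is_cofactor_unique b(2) by blast
  qed
  show ?thesis
    unfolding minimal_cofactor_set_def
    by (rule the_equality) (use cover least in blast)+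
qed

subsection \<open>Classification of the co-factors\<close>

lemma trunc_poly_8:
  "trunc_poly x 8 = [:- beta_digit x 8, - beta_digit x 7, - beta_digit x 6, - beta_digit x 5,
     - beta_digit x 4, - beta_digit x 3, - beta_digit x 2, - beta_digit x 1, 1:]"
  by (simp add: numeral_eq_Suc trunc_poly_Suc trunc_poly_0 one_pCons)

text \<open>Subtracting the first truncation, X minus the first digit, alters only the two lowest
  coefficients.\<close>

lemma companion_poly_1_7:
  assumes "preperiod_length x = 1" "period_length x = 7"
  shows "companion_poly x = [:beta_digit x 1 - beta_digit x 8, - beta_digit x 7 - 1,
     - beta_digit x 6, - beta_digit x 5, - beta_digit x 4, - beta_digit x 3,
     - beta_digit x 2, - beta_digit x 1, 1:]"
  using trunc_poly_8[of x] assms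
  by (simp add: companion_poly_def trunc_poly_Suc trunc_poly_0 one_pCons)

text \<open>Here \<open>v = c1 - c8\<close> is positive. If \<open>v >= 2\<close>, then
  \<open>Q1\<close> with \<open>v <= c1\<close> gives \<open>a <= 0\<close>, and the fourth equation
  becomes \<open>a * (v - 1) = c1 - c7 - 1 >= -1\<close>. Only \<open>a = 0\<close> and
  \<open>a = -1\<close> remain.\<close>

lemma cofactor_const_coeff_eq_1:
  fixes a b c u v :: int
  assumes eqs: "a + u = - c1" "b + a * u + v = - c2" "1 + a * u + b * v = - c6"
      "u + a * v = - c7 - 1" "v = c1 - c8"
    and c: "0 \<le> c2" "c2 \<le> c1" "0 \<le> c6" "c6 \<le> c1" "0 \<le> c7" "c7 \<le> c1" "0 \<le> c8" "c8 \<le> c1" "c8 \<noteq> c1"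
    and Q1: "1 + u + v > 0"
  shows "v = 1"
proof (rule ccontr)
  assume "v \<noteq> 1"
  then have v: "v \<ge> 2" using eqs c by linarith
  have u: "u = - c1 - a" using eqs by linarith
  have "v \<ge> c1 + a" using Q1 u by linarith
  then have "a \<le> 0" using eqs c by linarith
  moreover have a1: "a * (v - 1) \<ge> -1" 
  proof -
    have "a * (v - 1) = a * v - a" by (simp add: algebra_simps)
    then show ?thesis using eqs(4) u c by linarith
  qed
  have "a \<ge> -1"
  proof (rule ccontr)
    assume "\<not> a \<ge> -1"
    then have "a * (v - 1) \<le> (-2) * (v - 1)" using v by (intro mult_right_mono) auto
    also have "\<dots> \<le> -2" using v by simp
    finally show False using a1 by simp
  qed
  ultimately consider "a = 0" | "a = -1" by linarith
  then show False
  proof cases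
    case 1
    then have "v = c1" using \<open>v \<ge> c1 + a\<close> eqs c by linarith
    \<comment> \<open>The second equation bounds \<open>b * v\<close> above by
      \<open>- v * v\<close>, the third bounds it below by \<open>- 1 - v\<close>; these are
      incompatible for \<open>v >= 2\<close>.\<close>
    then have "b \<le> - v" using eqs 1 c by simp
    then have "b * v \<le> (- v) * v" using v by (intro mult_right_mono) auto
    moreover have "b * v \<ge> - 1 - v" using eqs c 1 \<open>v = c1\<close> by simp
    moreover have "2 * v \<le> v * v" using v by (intro mult_right_mono) auto
    ultimately show False using v by simp
  next
    case 2
    then have "v = 2" using a1 v by simp
    \<comment> \<open>Eliminating \<open>b\<close> and \<open>u\<close> gives
      \<open>c6 = c1 + 2 * c2 + 2\<close>, larger than any digit.\<close>
    then show False using 2 eqs c u by simp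
  qed
qed

text \<open>The case \<open>v = 1\<close>: both factors are reciprocal, hence so is their product,
  which gives \<open>c5 = c3\<close>, \<open>c6 = c2\<close> and \<open>c7 + 1 = c1\<close>.\<close>

lemma cofactor_linear_coeff:
  fixes a b c u :: int
  assumes eqs: "a + u = - c1" "b + a * u + 1 = - c2" "c + b * u + a = - c3" "b + c * u + b = - c4"
      "a + b * u + c = - c5" "1 + a * u + b = - c6" "u + a = - c7 - 1" "1 = c1 - c8"
    and c: "c2 \<le> c1" "c3 \<le> c1" "0 \<le> c3" "0 \<le> c4" "c4 \<le> c1"  "c1 > 0"
    and Q1: "2 + u > 0"
  shows "u = -1 \<or> u = 0 \<or> u = 2"
proof (rule ccontr)
  assume "\<not> ?thesis"
  then consider "u = 1" | "u \<ge> 3" using Q1 by linarith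
  then show False
  proof cases
    \<comment> \<open>Evaluating the companion polynomial at a primitive cube root of unity gives
      \<open>c2 + c3 = 1 + 2 * c1 + c4\<close>, which exceeds \<open>2 * c1\<close>.\<close>
    case 1
    then show False using eqs c by simp
  next
    \<comment> \<open>\<open>- r\<close> is a root of the co-factor below \<open>-2\<close>, too large in modulus for a polynomial
      whose coefficients are digits.\<close>
    case 2
    define r where "r = (real_of_int u + sqrt (real_of_int u ^ 2 - 4)) / 2"
    have u3: "real_of_int u \<ge> 3" using 2 by simp
    then have u9: "real_of_int u ^ 2 \<ge> 3 ^ 2" by (intro power_mono) auto
    have s: "sqrt (real_of_int u ^ 2 - 4) \<ge> 1" using u9 by simp
    have s2: "sqrt (real_of_int u ^ 2 - 4) ^ 2 = real_of_int u ^ 2 - 4" using u9 by simp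
    have r2: "r \<ge> 2" using add_mono[OF u3 s] unfolding r_def by simp
    have "r ^ 2 - u * r + 1 = 0"
      using s2 unfolding r_def by (simp add: power2_eq_square field_simps)
    \<comment> \<open>The second factor is the sextic at \<open>- r\<close>, so the product is the
      companion polynomial at \<open>- r\<close>, with the signs of its odd terms changed.\<close>
    then have "(r ^ 2 - u * r + 1) * (r ^ 6 - a * r ^ 5 + b * r ^ 4 - c * r ^ 3 + b * r ^ 2 - a * r + 1) = 0"
      by simp
    also have "(r ^ 2 - u * r + 1) * (r ^ 6 - a * r ^ 5 + b * r ^ 4 - c * r ^ 3 + b * r ^ 2 - a * r + 1) = 
       r ^ 8 - real_of_int (a + u) * r ^ 7 + real_of_int (b + a * u + 1) * r ^ 6
       - real_of_int (c + b * u + a) * r ^ 5 + real_of_int (b + c * u + b) * r ^ 4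
       - real_of_int (a + b * u + c) * r ^ 3 + real_of_int (1 + a * u + b) * r ^ 2
       - real_of_int (u + a) * r + 1"
      by (simp add: algebra_simps power_numeral_reduce power2_eq_square)
    also have "\<dots> = r ^ 8 + c1 * r ^ 7 - c2 * r ^ 6 + c3 * r ^ 5 - c4 * r ^ 4 + c3 * r ^ 3
       - c2 * r ^ 2 + c1 * r + 1"
    proof -
      have "c5 = c3" "c6 = c2" "c7 + 1 = c1" using eqs by linarith+
      then have "real_of_int c7 = c1 - 1" by linarith
      then show ?thesis unfolding eqs(1-7) \<open>c5 = c3\<close> \<open>c6 = c2\<close> by simp
    qed
    finally have eq0: "r ^ 8 + c1 * r ^ 7 - c2 * r ^ 6 + c3 * r ^ 5 - c4 * r ^ 4 + c3 * r ^ 3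
       - c2 * r ^ 2 + c1 * r + 1 = 0" .
    have c': "real_of_int c2 \<le> c1" "real_of_int c4 \<le> c1" "real_of_int c3 \<ge> 0" "real_of_int c1 > 0"
      using c by simp_all
    have "c2 * r ^ 6 \<le> c1 * r ^ 6" "c4 * r ^ 4 \<le> c1 * r ^ 4" "c2 * r ^ 2 \<le> c1 * r ^ 2"
      using c' r2 by (intro mult_right_mono; simp)+
    moreover have "0 \<le> c3 * r ^ 5" "0 \<le> c3 * r ^ 3" "0 \<le> r ^ 8" "0 < c1 * r" using c' r2 by simp_all
    \<comment> \<open>The term \<open>c1 * r ^ 7\<close> absorbs all three negative terms: for
      \<open>r >= 2\<close>, \<open>r ^ 6 + r ^ 4 + r ^ 2\<close> is below \<open>2 * r ^ 6\<close>,
      which is at most \<open>r ^ 7\<close>.\<close>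
    moreover have "c1 * (r ^ 6 + r ^ 4 + r ^ 2) \<le> c1 * r ^ 7"
    proof (rule mult_left_mono)
      have p: "r ^ 2 \<ge> 0" "r ^ 4 \<ge> 4 * r ^ 2" "r ^ 6 \<ge> 4 * r ^ 4" "r ^ 7 \<ge> 2 * r ^ 6"
      proof -
        have "r ^ 2 \<ge> 2 ^ 2" by (rule power_mono) (use r2 in auto)
        then have "4 \<le> r * r" by (simp add: power2_eq_square)
        then have "4 * r ^ 2 \<le> r * r * r ^ 2" "4 * r ^ 4 \<le> r * r * r ^ 4" by (intro mult_right_mono; simp)+
        then show "r ^ 4 \<ge> 4 * r ^ 2" "r ^ 6 \<ge> 4 * r ^ 4" by (simp_all add: power_numeral_reduce mult_ac)
        have "2 * r ^ 6 \<le> r * r ^ 6" using r2 by (intro mult_right_mono) auto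
        then show "r ^ 7 \<ge> 2 * r ^ 6" by (simp add: power_numeral_reduce mult_ac)
      qed simp
      then show "r ^ 6 + r ^ 4 + r ^ 2 \<le> r ^ 7" by linarith
    qed (use c' in simp)
    ultimately show False using eq0 unfolding distrib_left by linarith
  qed
qed

text \<open>Over a period of zero digits the remainder would be multiplied by
  \<open>x ^ p > 1\<close> and yet return to its nonzero starting value. This makes the companion
  polynomial strictly negative at 1.\<close>

lemma beta_digit_nonzero_in_period:
  assumes "x > 1" "periodic_from x m p" "\<forall>n. beta_rem x n \<noteq> 0"
  shows "\<exists>n \<in> {m<..m + p}. beta_digit x n \<noteq> 0"
proof (rule ccontr)
  assume *: "\<not> ?thesis"
  have "k \<le> p \<Longrightarrow> beta_rem x (m + k) = x ^ k * beta_rem x m" for k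
  proof (induction k)
    case (Suc k)
    have "beta_digit x (Suc (m + k)) = 0" using * Suc.prems by auto
    then show ?case using Suc by (simp add: beta_rem_Suc del: beta_rem.simps(2))
  qed simp
  then have "beta_rem x m = x ^ p * beta_rem x m"
    using beta_rem_eq_of_periodic[OF assms(1,2), of 0] by simp
  then have "x ^ p = 1" using assms(3) by (metis mult_cancel_right1)
  moreover have "x ^ p > 1" using assms(1,2) by (simp add: periodic_from_def)
  ultimately show False by simp
qed

lemma cofactor_classification:
  assumes x: "x \<in> salem_numbers 6 \<inter> salem_parry_numbers 1 7" and q: "is_cofactor x q"
  shows "q \<in> {[:1, -1, 1:], [:1, 0, 1:], [:1, 2, 1:]}"
proof -
  have sx: "salem x" "degree (min_poly x) = 6" "parry x" "preperiod_length x = 1" "period_length x = 7"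
    using x by (auto simp: salem_numbers_def salem_parry_numbers_def)
  have x1: "x > 1" using sx by (simp add: salem_def)
  define c where "c = beta_digit x"
  obtain M where M: "min_poly x = map_poly of_int M" "lead_coeff M = 1"
    using min_poly_algebraic_int[of x] sx by (auto simp: salem_def)
  have dM: "degree M = 6" using sx M by (simp add: degree_map_poly)
  have rM: "coeff M n = coeff M (6 - n)" if "n \<le> 6" for n
  proof -
    have "coeff (reflect_poly (min_poly x)) n = coeff (min_poly x) n"
      using salem_min_poly_reciprocal[OF sx(1)] by simp
    then show ?thesis using that dM by (simp add: M(1) coeff_reflect_poly degree_map_poly coeff_map_poly)
  qed
  define a b d where "a = coeff M 1" and "b = coeff M 2" and "d = coeff M 3"
  have Meq: "M = [:1, a, b, d, b, a, 1:]"
    using poly_eq_Poly_coeffs[of M 7] rM[of 4] rM[of 5] rM[of 0] M(2) dM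
    by (simp add: a_def b_def d_def upt_rec numeral_eq_Suc)
  have period: "periodic_from x 1 7"
    using parry_periodic_from[OF sx(3)] sx by simp
  \<comment> \<open>The period length 7 is not the conventional 0, so no remainder vanishes.\<close>
  have nz: "\<forall>n. beta_rem x n \<noteq> 0" using sx(5) unfolding period_length_def by (auto split: if_splits)
  have R: "companion_poly x = M * q"
    using q unfolding is_cofactor_def M(1) map_poly_of_int_mult[symmetric] map_poly_of_int_eq_iff by blast
  have dq: "degree q = 2" using degree_is_cofactor[OF q] sx by simp
  have "lead_coeff (companion_poly x) = 1" using companion_poly_monic(2)[of x] sx by simp
  then have lq: "lead_coeff q = 1" unfolding R lead_coeff_mult M by simp
  define u v where "u = coeff q 1" and "v = coeff q 0"
  have qeq: "q = [:v, u, 1:]"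
    using poly_eq_Poly_coeffs[of q 3] lq dq by (simp add: u_def v_def upt_rec numeral_eq_Suc)
  have eqs: "a + u = - c 1" "b + a * u + v = - c 2" "d + b * u + a * v = - c 3"
      "b + d * u + b * v = - c 4" "a + b * u + d * v = - c 5" "1 + a * u + b * v = - c 6"
      "u + a * v = - c 7 - 1" "v = c 1 - c 8"
    using R unfolding companion_poly_1_7[OF sx(4,5)] Meq qeq c_def by (auto simp: algebra_simps)
  have c: "0 \<le> c n" "c n \<le> c 1" if "n > 0" for n
    using beta_digit_bounds[OF x1 that] by (simp_all add: c_def)
  have c1: "c 1 > 0" using x1 beta_digit_1[of x] by (simp add: c_def)
  \<comment> \<open>Equality would extend the period 7 back to the first digit and make the
    preperiod 0.\<close>
  have c8: "c 8 \<noteq> c 1"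
  proof
    assume "c 8 = c 1"
    have "beta_digit x (n + 0) = beta_digit x (n + 0 + 7)" if "n \<ge> 1" for n
    proof (cases "n = 1")
      case True
      then show ?thesis using \<open>c 8 = c 1\<close> by (simp add: c_def)
    next
      case False
      then have "n - 1 \<ge> 1" using that by simp
      then have "beta_digit x (n - 1 + 1) = beta_digit x (n - 1 + 1 + 7)"
        using period unfolding periodic_from_def by blast
      then show ?thesis using that by simp
    qed
    then have "\<forall>n\<ge>1. beta_digit x (n + 0) = beta_digit x (n + 0 + 7)" by blast
    moreover have "(7::nat) \<ge> 1" by simp
    ultimately have "periodic_from x 0 7" unfolding periodic_from_def by blast
    then have "preperiod_length x \<le> 0" unfolding preperiod_length_def by (intro Least_le exI)
    then show False using sx by simp
  qed
  \<comment> \<open>At 1 the companion polynomial is minus the digit sum over one period, hence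
    negative. The sextic is negative there as well, so the co-factor is positive.\<close>
  have Q1: "1 + u + v > 0"
  proof -
    obtain n where n: "n \<in> {1<..1 + 7}" "c n \<noteq> 0"
      using beta_digit_nonzero_in_period[OF x1 period nz] unfolding c_def by blast
    then have "c n > 0" using c(1)[of n] by simp
    then have "(\<Sum>n\<in>{1<..1 + 7}. c n) > 0"
      by (intro sum_pos2[OF _ n(1)]) (use c(1) in auto)
    moreover have "{1<..1 + 7} = {2, 3, 4, 5, 6, 7, 8::nat}" by auto
    ultimately have "c 2 + c 3 + c 4 + c 5 + c 6 + c 7 + c 8 > 0" by simp
    moreover have "poly (companion_poly x) 1 = - (c 2 + c 3 + c 4 + c 5 + c 6 + c 7 + c 8)"
      unfolding companion_poly_1_7[OF sx(4,5)] by (simp add: c_def)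
    ultimately have "poly M 1 * poly q 1 < 0" unfolding R by simp
    moreover have "poly (map_poly of_rat (min_poly x)) (1::real) = of_int (poly M 1)"
      unfolding M(1) map_poly_of_rat_of_int Meq by (simp add: map_poly_pCons)
    then have "poly M 1 < 0" using salem_min_poly_at_1_neg[OF sx(1)] by simp
    ultimately have "poly q 1 > 0" by (simp add: mult_less_0_iff)
    then show ?thesis unfolding qeq by simp
  qed
  have v: "v = 1"
    by (rule cofactor_const_coeff_eq_1[OF eqs(1,2,6,7,8)]) (use c c8 Q1 in auto)
  have "u = -1 \<or> u = 0 \<or> u = 2"
    by (rule cofactor_linear_coeff[of a u "c 1" b "c 2" d "c 3" "c 4" "c 5" "c 6" "c 7" "c 8"])
       (use eqs c c1 Q1 in \<open>simp_all add: v\<close>)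
  then show ?thesis using v qeq by auto
qed

subsection \<open>Salem numbers of degree six\<close>

text \<open>Modulo 2 the sextic is \<open>x^6 + x^3 + 1\<close>, which is irreducible over the field with two elements.\<close>

lemma parity_sextic_low_degree_factor:
  fixes F G :: "int poly"
  assumes FG: "F * G = [:1, a, b, c, b, a, 1:]" and lc: "lead_coeff F = 1" "lead_coeff G = 1"
    and par: "even a" "even b" "odd c" and deg: "degree F \<le> 3"
  shows "degree F = 0"
proof (rule ccontr)
  assume "degree F \<noteq> 0"
  have "F \<noteq> 0" "G \<noteq> 0" using lc by auto
  then have dFG: "degree F + degree G = 6" using arg_cong[OF FG, of degree] by (simp add: degree_mult_eq)
  consider "degree F = 1" | "degree F = 2" | "degree F = 3" using deg \<open>degree F \<noteq> 0\<close> by linarith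
  then show False
  proof cases
    case 1
    define f where "f = coeff F 0"
    have F: "F = [:f, 1:]" using poly_eq_Poly_coeffs[of F 2] lc 1 by (simp add: f_def upt_rec)
    have "poly [:1, a, b, c, b, a, 1:] (- f) = 0" unfolding FG[symmetric] F by simp
    \<comment> \<open>The sextic is odd at every integer: at even ones by its constant term 1, at
      odd ones because its coefficient sum is odd.\<close>
    then have "even (poly [:1, a, b, c, b, a, 1:] (- f))" by simp
    then show False using par by (cases "even f") simp_all
  next
    case 2
    then have dG: "degree G = 4" using dFG by simp
    obtain f0 f1 where F: "F = [:f0, f1, 1:]"
      using poly_eq_Poly_coeffs[of F 3] lc 2 by (simp add: upt_rec numeral_eq_Suc)
    obtain g0 g1 g2 g3 where G: "G = [:g0, g1, g2, g3, 1:]"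
      using poly_eq_Poly_coeffs[of G 5] lc dG by (simp add: upt_rec numeral_eq_Suc)
    have eqs: "f0 * g0 = 1" "f0 * g1 + f1 * g0 = a" "f0 * g2 + f1 * g1 + g0 = b"
        "f0 * g3 + f1 * g2 + g1 = c" "f0 + f1 * g3 + g2 = b" "f1 + g3 = a"
      using FG unfolding F G by (auto simp: algebra_simps)
    \<comment> \<open>Only parities are kept. Factoring over the field with two elements becomes a
      propositional problem without solution; the cubic case below ends likewise.\<close>
    have "odd (f0 * g0)" "even (f0 * g1 + f1 * g0)" "even (f0 * g2 + f1 * g1 + g0)"
        "odd (f0 * g3 + f1 * g2 + g1)" "even (f0 + f1 * g3 + g2)" "even (f1 + g3)"
      unfolding eqs using par by simp_all
    then show False unfolding even_add even_mult_iff by blast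
  next
    case 3
    then have dG: "degree G = 3" using dFG by simp
    obtain f0 f1 f2 where F: "F = [:f0, f1, f2, 1:]"
      using poly_eq_Poly_coeffs[of F 4] lc 3 by (simp add: upt_rec numeral_eq_Suc)
    obtain g0 g1 g2 where G: "G = [:g0, g1, g2, 1:]"
      using poly_eq_Poly_coeffs[of G 4] lc dG by (simp add: upt_rec numeral_eq_Suc)
    have eqs: "f0 * g0 = 1" "f0 * g1 + f1 * g0 = a" "f0 * g2 + f1 * g1 + f2 * g0 = b"
        "f0 + f1 * g2 + f2 * g1 + g0 = c" "f1 + f2 * g2 + g1 = b" "f2 + g2 = a"
      using FG unfolding F G by (auto simp: algebra_simps)
    have "odd (f0 * g0)" "even (f0 * g1 + f1 * g0)" "even (f0 * g2 + f1 * g1 + f2 * g0)"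
        "odd (f0 + f1 * g2 + f2 * g1 + g0)" "even (f1 + f2 * g2 + g1)" "even (f2 + g2)"
      unfolding eqs using par by simp_all
    then show False unfolding even_add even_mult_iff by blast
  qed
qed

text \<open>By Gauss' lemma the sextic is an integral product of the minimal polynomial and a
  quotient. One of the two has degree at most 3 and is therefore constant; it can only be the
  quotient.\<close>

lemma min_poly_sextic:
  fixes x :: real and a b c :: int
  assumes par: "even a" "even b" "odd c"
    and root: "poly (map_poly of_int [:1, a, b, c, b, a, 1:]) x = 0"
  shows "algebraic_int x" "min_poly x = map_poly of_int [:1, a, b, c, b, a, 1:]"
proof -
  let ?P = "[:1, a, b, c, b, a, 1:] :: int poly"
  show ai: "algebraic_int x"
    unfolding algebraic_int_altdef_ipoly using root by (intro exI[of _ ?P]) simp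
  obtain F where F: "min_poly x = map_poly of_int F" "lead_coeff F = 1"
    using min_poly_algebraic_int[OF ai] by blast
  have rP: "poly (map_poly of_rat (map_poly of_int ?P)) x = 0"
    unfolding map_poly_of_rat_of_int by (rule root)
  have "(map_poly of_int ?P :: rat poly) \<noteq> 0" by (simp add: map_poly_pCons)
  then have m: "is_min_poly x (min_poly x)" using rP by (rule is_min_poly_min_poly)
  then obtain k where k: "map_poly of_int ?P = k * min_poly x"
    using is_min_poly_dvd[OF m rP] by (metis dvdE mult.commute)
  have lm: "lead_coeff (min_poly x) = 1" using m by (simp add: is_min_poly_def)
  have "lead_coeff (k * min_poly x) = 1" unfolding k[symmetric] by (simp add: map_poly_pCons)
  then have lk: "lead_coeff k = 1" using lm by (simp add: lead_coeff_mult)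
  obtain G where G: "k = map_poly of_int G" using monic_rat_factors_int[OF k[symmetric] lk lm] by blast
  have lG: "lead_coeff G = 1" using lk lead_coeff_map_of_int[of G, where 'a=rat] unfolding G by simp
  have PGF: "G * F = ?P"
    using k unfolding F(1) G map_poly_of_int_mult[symmetric] map_poly_of_int_eq_iff by simp
  have "F \<noteq> 0" "G \<noteq> 0" using F(2) lG by auto
  then have deg: "degree G + degree F = 6" using arg_cong[OF PGF, of degree] by (simp add: degree_mult_eq)
  have dF: "degree F \<noteq> 0"
  proof
    assume "degree F = 0"
    then obtain e where "F = [:e:]" by (rule degree_eq_zeroE)
    then have "F = 1" using F(2) by (simp add: one_pCons)
    then have "min_poly x = 1" using F(1) by simp
    then show False using m by (simp add: is_min_poly_def)
  qed
  have "degree G = 0"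
  proof (cases "degree G \<le> 3")
    case True
    then show ?thesis using parity_sextic_low_degree_factor[OF PGF lG F(2) par] by simp
  next
    case False
    then have "degree F \<le> 3" using deg by simp
    then show ?thesis
      using parity_sextic_low_degree_factor[of F G] PGF lG F(2) par dF by (simp add: mult.commute)
  qed
  then obtain e where "G = [:e:]" by (rule degree_eq_zeroE)
  then have "G = 1" using lG by (simp add: one_pCons)
  then show "min_poly x = map_poly of_int ?P" using PGF F(1) by simp
qed

text \<open>Divided differences: subtract root equations and cancel the nonzero differences of the
  roots.\<close>

lemma cubic_vieta:
  fixes a p q s t g :: real
  assumes "s \<noteq> t" "s \<noteq> g" "t \<noteq> g"
    "s^3 + a * s^2 + p * s + q = 0" "t^3 + a * t^2 + p * t + q = 0" "g^3 + a * g^2 + p * g + q = 0"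
  shows "a = - (s + t + g)" "p = s * t + s * g + t * g" "q = - (s * t * g)"
proof -
  have "(s - t) * (s^2 + s * t + t^2 + a * (s + t) + p) = 0"
    using assms(4,5) by (simp add: algebra_simps power_numeral_reduce)
  then have 1: "s^2 + s * t + t^2 + a * (s + t) + p = 0" using assms(1) by simp
  have "(s - g) * (s^2 + s * g + g^2 + a * (s + g) + p) = 0"
    using assms(4,6) by (simp add: algebra_simps power_numeral_reduce)
  then have 2: "s^2 + s * g + g^2 + a * (s + g) + p = 0" using assms(2) by simp
  have "(t - g) * (s + t + g + a) = 0"
    using 1 2 by (simp add: algebra_simps power_numeral_reduce)
  then show a: "a = - (s + t + g)" using assms(3) by simp
  show p: "p = s * t + s * g + t * g"
    using 1 unfolding a by (simp add: algebra_simps power_numeral_reduce)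
  show "q = - (s * t * g)"
    using assms(4) unfolding a p by (simp add: algebra_simps power_numeral_reduce)
qed

text \<open>The discriminant \<open>s^2 - 4\<close> is negative, so the root is not real. The
  imaginary part of the equation then gives real part \<open>s / 2\<close>, and the real part gives
  modulus 1.\<close>

lemma norm_eq_1_of_quadratic:
  fixes z :: complex and s :: real
  assumes "\<bar>s\<bar> < 2" "z^2 - of_real s * z + 1 = 0"
  shows "cmod z = 1"
proof -
  obtain p q where z: "z = Complex p q" by (cases z)
  have re: "p^2 - q^2 - s * p + 1 = 0" and im: "q * (2 * p - s) = 0"
    using assms(2) unfolding z by (simp_all add: complex_eq_iff power2_eq_square algebra_simps)
  have "q \<noteq> 0"
  proof
    assume "q = 0"
    then have "(p - s / 2)^2 = s^2 / 4 - 1" using re by (simp add: power2_eq_square field_simps)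
    moreover have "s^2 < 2^2" using assms(1) by (metis abs_ge_zero power2_abs power_strict_mono zero_less_numeral)
    ultimately have "(p - s / 2)^2 < 0" by simp
    then show False by (simp add: not_less[symmetric])
  qed
  then have "s = 2 * p" using im by simp
  then have "p^2 + q^2 = 1" using re by (simp add: power2_eq_square)
  then show ?thesis unfolding z by (simp add: cmod_def)
qed

text \<open>The cubic in the hypotheses \<open>trace\<close> is the trace polynomial, whose roots are the sums
  \<open>z + 1 / z\<close> over the roots \<open>z\<close> of the sextic.\<close>

lemma salem_sextic:
  fixes x :: real and a b c t0 :: int
  assumes par: "even a" "even b" "odd c"
    and root: "poly (map_poly of_int [:1, a, b, c, b, a, 1:]) x = 0" and x: "x > 1"
    and trace: "poly [:c - 2 * a, b - 3, a, 1:] (-2) < 0" "poly [:c - 2 * a, b - 3, a, 1:] t0 > 0"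
      "poly [:c - 2 * a, b - 3, a, 1:] 2 < 0" "-2 < t0" "t0 < 2"
  shows "salem x"
proof -
  note mp = min_poly_sextic[OF par root]
  define T :: "real poly" where "T = [:c - 2 * a, b - 3, a, 1:]"
  have Teq: "poly T (of_int k) = of_int (poly [:c - 2 * a, b - 3, a, 1:] k)" for k
    by (simp add: T_def)
  have T: "poly T (-2) < 0" "poly T t0 > 0" "poly T 2 < 0"
    using trace(1,2,3) unfolding of_int_less_iff[where 'a=real, symmetric] Teq[symmetric] by simp_all
  \<comment> \<open>The sign changes place two trace roots in (-2, 2), on either side of
    \<open>t0\<close>; the third is \<open>g = x + 1 / x > 2\<close>.\<close>
  obtain s :: real where s: "-2 < s" "s < t0" "poly T s = 0"
    using poly_IVT_pos[of "-2" t0 T] T trace(4) by auto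
  obtain t :: real where t: "t0 < t" "t < 2" "poly T t = 0"
    using poly_IVT_neg[of t0 2 T] T trace(5) by auto
  define g where "g = x + 1 / x"
  have xg: "x * g = x^2 + 1" using x by (simp add: g_def power2_eq_square field_simps)
  have "g - 2 = (x - 1)^2 / x" using x by (simp add: g_def power2_eq_square field_simps)
  moreover have "(x - 1)^2 / x > 0" using x by simp
  ultimately have g2: "g > 2" by linarith
  have "x^3 * poly T g = (x * g)^3 + a * x * (x * g)^2 + (b - 3) * x^2 * (x * g) + (c - 2 * a) * x^3"
    by (simp add: T_def algebra_simps power_numeral_reduce)
  also have "\<dots> = x^6 + a * x^5 + b * x^4 + c * x^3 + b * x^2 + a * x + 1"
    unfolding xg by (simp add: algebra_simps power_numeral_reduce)
  also have "\<dots> = 0"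
    using root by (simp add: map_poly_pCons algebra_simps power_numeral_reduce)
  finally have Tg: "poly T g = 0" using x by simp
  have cubic: "y^3 + a * y^2 + (b - 3) * y + (c - 2 * a) = 0" if "poly T y = 0" for y :: real
    using that by (simp add: T_def algebra_simps power_numeral_reduce)
  have "s \<noteq> t" "s \<noteq> g" "t \<noteq> g" using s t g2 trace(5) by auto
  note vieta = cubic_vieta[OF this cubic[OF s(3)] cubic[OF t(3)] cubic[OF Tg]]
  \<comment> \<open>Each trace root contributes a quadratic factor whose zeros are mutually
    inverse.\<close>
  have fact: "poly (map_poly of_int [:1, a, b, c, b, a, 1:]) z =
      (z^2 - of_real s * z + 1) * (z^2 - of_real t * z + 1) * (z^2 - of_real g * z + 1)" for z :: complex
  proof -
    have a': "of_int a = - (of_real s + of_real t + of_real g :: complex)"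
      using arg_cong[OF vieta(1), of complex_of_real] by simp
    have b': "of_int b = 3 + (of_real s * of_real t + of_real s * of_real g + of_real t * of_real g :: complex)"
      using arg_cong[OF vieta(2), of complex_of_real] by (simp add: algebra_simps)
    have c': "of_int c = 2 * of_int a - (of_real s * of_real t * of_real g :: complex)"
      using arg_cong[OF vieta(3), of complex_of_real] by (simp add: algebra_simps)
    show ?thesis
      by (simp add: map_poly_pCons c' b' a' algebra_simps power_numeral_reduce)
  qed
  have conj: "galois_conjugates x = {z. (z^2 - of_real s * z + 1) * (z^2 - of_real t * z + 1) * (z^2 - of_real g * z + 1) = 0}"
    unfolding galois_conjugates_def mp(2) map_poly_of_rat_of_int fact ..
  have st: "\<bar>s\<bar> < 2" "\<bar>t\<bar> < 2" using s t trace(4,5) by auto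
  have "cmod z \<le> 1" if z: "z \<in> galois_conjugates x - {of_real x}" for z
  proof -
    consider "z^2 - of_real s * z + 1 = 0" | "z^2 - of_real t * z + 1 = 0" | "z^2 - of_real g * z + 1 = 0"
      using z unfolding conj by auto
    then show ?thesis
    proof cases
      case 3
      \<comment> \<open>The factor of \<open>g\<close> has the roots \<open>x\<close> and
        \<open>1 / x\<close>. Only the latter differs from \<open>x\<close>, and it lies inside the
        unit disc.\<close>
      have "complex_of_real x * g = of_real (x^2 + 1)" unfolding xg[symmetric] by simp
      then have "(z - of_real x) * (of_real x * z - 1) = of_real x * (z^2 - of_real g * z + 1)"
        by (simp add: algebra_simps power2_eq_square)
      then have "of_real x * z = 1" using z 3 by simp
      then have "x * cmod z = 1" using x by (metis abs_of_pos norm_mult norm_of_real norm_one less_trans zero_less_one)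
      then have "cmod z = 1 / x" using x by (simp add: field_simps)
      then show ?thesis using x by simp
    qed (use norm_eq_1_of_quadratic[of _ z] st in force)+
  qed
  moreover have "\<exists>z \<in> galois_conjugates x - {of_real x}. cmod z = 1"
  proof -
    \<comment> \<open>The root in the upper half plane of the quadratic belonging to
      \<open>s\<close>.\<close>
    define z where "z = Complex (s / 2) (sqrt (1 - s^2 / 4))"
    have "s^2 < 2^2" using st(1) by (metis abs_ge_zero power2_abs power_strict_mono zero_less_numeral)
    then have "sqrt (1 - s^2 / 4) ^ 2 = 1 - s^2 / 4" by simp
    then have "z^2 - of_real s * z + 1 = 0"
      by (simp add: z_def complex_eq_iff power2_eq_square field_simps)
    moreover from this have "cmod z = 1" by (rule norm_eq_1_of_quadratic[OF st(1)])
    moreover from this have "z \<noteq> of_real x" using x by auto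
    ultimately show ?thesis unfolding conj by auto
  qed
  ultimately show ?thesis unfolding salem_def using mp(1) x by blast
qed

subsection \<open>Witnesses\<close>

text \<open>One step of interval arithmetic for the greedy recursion, from enclosures of
  \<open>x\<close> and of a remainder. The new bounds \<open>l'\<close> and \<open>u'\<close> are
  free, so that rounded decimals can be supplied; the premise \<open>k = Suc n\<close> admits
  numerals for \<open>k\<close>.\<close>

lemma beta_step:
  assumes "lo \<le> x" "x \<le> hi" "0 \<le> lo" "0 \<le> l" "l \<le> beta_rem x n" "beta_rem x n \<le> u"
    "k = Suc n" "of_int d \<le> lo * l" "hi * u < of_int d + 1" "l' \<le> lo * l - of_int d" "hi * u - of_int d \<le> u'"
  shows "beta_digit x k = d" "l' \<le> beta_rem x k" "beta_rem x k \<le> u'"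
proof -
  have lower: "lo * l \<le> x * beta_rem x n" by (rule mult_mono) (use assms in auto)
  have upper: "x * beta_rem x n \<le> hi * u" by (rule mult_mono) (use assms in auto)
  show d: "beta_digit x k = d"
    unfolding beta_digit_def \<open>k = Suc n\<close> using lower upper assms by (simp add: floor_eq_iff)
  have "beta_rem x k = x * beta_rem x n - of_int d"
    using d unfolding \<open>k = Suc n\<close> beta_rem_Suc by simp
  then show "l' \<le> beta_rem x k" "beta_rem x k \<le> u'"
    using lower upper assms by linarith+
qed

text \<open>As \<open>p\<close> is invertible modulo 7, some multiple of \<open>p\<close> exceeds a
  multiple of 7 by 1, so \<open>f\<close> has period 1. The proof lists the inverses.\<close>

lemma constant_of_periods_coprime_7:
  assumes p7: "\<And>n. n \<ge> 1 \<Longrightarrow> f (n + 7) = f n" and pp: "\<And>n. n \<ge> 1 \<Longrightarrow> f (n + p) = f n"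
    and p: "1 \<le> p" "p < (7::nat)" and n: "n \<ge> (1::nat)"
  shows "f n = f 1"
proof -
  have iter: "f (n + k * q) = f n" if "\<And>n. n \<ge> 1 \<Longrightarrow> f (n + q) = f n" "n \<ge> 1" for n k q
  proof (induction k)
    case (Suc k)
    have "f (n + k * q + q) = f (n + k * q)" using that(1)[of "n + k * q"] that(2) by simp
    then show ?case using Suc by (simp add: algebra_simps)
  qed simp
  obtain i j where ij: "i * p = 1 + j * 7"
  proof -
    consider "p = 1" | "p = 2" | "p = 3" | "p = 4" | "p = 5" | "p = 6" using p by linarith
    then show ?thesis
      by cases (use that[of 1 0] that[of 4 1] that[of 5 2] that[of 2 1] that[of 3 2] that[of 6 5] in auto)
  qed
  have step: "f (n + 1) = f n" if "n \<ge> 1" for n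
  proof -
    have "f n = f (n + i * p)" using iter[OF pp that] by simp
    also have "n + i * p = (n + 1) + j * 7" using ij by simp
    also have "f \<dots> = f (n + 1)" by (rule iter[OF p7]) simp_all
    finally show ?thesis ..
  qed
  show ?thesis using n by (induction n rule: dec_induct) (auto simp: step[simplified])
qed

text \<open>The equal remainders give period 7 after the first digit. A shorter period would make
  all later digits equal, against the choice of \<open>i\<close>. Positive remainders exclude a
  finite expansion.\<close>

lemma parry_1_7I:
  assumes x: "x > 1" and rem: "beta_rem x 8 = beta_rem x 1" and pos: "\<forall>n\<in>{1..7}. beta_rem x n > 0"
    and d: "beta_digit x 8 \<noteq> beta_digit x 1" "i \<in> {2..8}" "beta_digit x i \<noteq> beta_digit x 2"
  shows "parry x" "preperiod_length x = 1" "period_length x = 7"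
proof -
  have rem7: "beta_rem x (Suc n + 7) = beta_rem x (Suc n)" for n
  proof (induction n)
    case 0
    then show ?case using rem by (simp add: numeral_eq_Suc)
  next
    case (Suc n)
    have "beta_rem x (Suc (Suc n + 7)) = beta_rem x (Suc (Suc n))"
      unfolding beta_rem.simps(2) Suc.IH ..
    then show ?case by simp
  qed
  have dig7: "beta_digit x (n + 1 + 7) = beta_digit x (n + 1)" if "n \<ge> 1" for n
    using rem7[of "n - 1"] that by (simp add: beta_digit_def add.commute)
  have per: "periodic_from x 1 7"
    unfolding periodic_from_def using dig7 by (metis one_le_numeral)
  show "parry x" using x per unfolding parry_def by blast
  \<comment> \<open>The digit at index \<open>1 + p * 7\<close> would equal the first one by the
    pure period \<open>p\<close>, but it equals the eighth one by the period 7.\<close>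
  have no0: "\<not> periodic_from x 0 p" for p
  proof
    assume p: "periodic_from x 0 p"
    then have s: "beta_digit x (n + p) = beta_digit x n" if "n \<ge> 1" for n
      using that unfolding periodic_from_def by (metis add.right_neutral)
    have "beta_digit x (1 + k * p) = beta_digit x 1" for k
    proof (induction k)
      case (Suc k)
      then show ?case using s[of "1 + k * p"] by (simp add: algebra_simps)
    qed simp
    then have *: "beta_digit x (1 + p * 7) = beta_digit x 1" by (metis mult.commute)
    have "beta_digit x (8 + k * 7) = beta_digit x 8" for k
    proof (induction k)
      case (Suc k)
      then show ?case using dig7[of "7 + k * 7"] by (simp add: algebra_simps)
    qed simp
    moreover have "p \<ge> 1" using p unfolding periodic_from_def by blast
    then have "8 + (p - 1) * 7 = 1 + p * 7" by (cases p) auto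
    ultimately have "beta_digit x (1 + p * 7) = beta_digit x 8" by metis
    then show False using d(1) * by simp
  qed
  show pre: "preperiod_length x = 1"
    unfolding preperiod_length_def
  proof (rule Least_equality)
    show "\<exists>p. periodic_from x 1 p" using per by blast
    show "1 \<le> m" if "\<exists>p. periodic_from x m p" for m
      using that no0 by (cases m) auto
  qed
  have nz: "beta_rem x n \<noteq> 0" for n
  proof (induction n rule: less_induct)
    case (less n)
    consider "n = 0" | "n \<in> {1..7}" | "n \<ge> 8" by force
    then show ?case
    proof cases
      case 3
      then have "beta_rem x n = beta_rem x (n - 7)" using rem7[of "n - 8"] by (simp add: Suc_diff_le[symmetric] numeral_eq_Suc)
      then show ?thesis using less[of "n - 7"] 3 by simp
    qed (use pos in force)+
  qed
  have "(LEAST p. periodic_from x 1 p) = 7"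
  proof (rule Least_equality[where x = 7])
    show "periodic_from x 1 7" by (rule per)
    fix p assume p: "periodic_from x 1 p"
    show "7 \<le> p"
    proof (rule ccontr)
      assume "\<not> 7 \<le> p"
      then have p': "1 \<le> p" "p < 7" using p unfolding periodic_from_def by auto
      define f where "f n = beta_digit x (n + 1)" for n
      have f7: "f (n + 7) = f n" if "n \<ge> 1" for n
        using dig7[OF that] by (simp add: f_def)
      have "beta_digit x (n + 1) = beta_digit x (n + 1 + p)" if "n \<ge> 1" for n
        using p that unfolding periodic_from_def by blast
      then have fp: "f (n + p) = f n" if "n \<ge> 1" for n
        unfolding f_def using that by (metis add.assoc add.commute)
      have "f (i - 1) = f 1"
        by (rule constant_of_periods_coprime_7[OF f7 fp p']) (use d(2) in auto)
      moreover have "f (i - 1) = beta_digit x i" "f 1 = beta_digit x 2"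
        using d(2) by (simp_all add: f_def numeral_2_eq_2)
      ultimately show False using d(3) by simp
    qed
  qed
  then show "period_length x = 7" using nz pre by (simp add: period_length_def)
qed

text \<open>Reduces a witness to eight digits. Interval bounds cannot establish the exact equality
  of the first and eighth remainders; it follows from \<open>fact\<close>, since the sextic vanishes
  at \<open>x\<close>.\<close>

lemma cofactor_witness:
  fixes x :: real and a b c e :: int
  assumes par: "even a" "even b" "odd c"
    and root: "poly (map_poly of_int [:1, a, b, c, b, a, 1:]) x = 0" and x: "x > 1"
    and trace: "poly [:c - 2 * a, b - 3, a, 1:] (-2) < 0" "poly [:c - 2 * a, b - 3, a, 1:] e > 0"
      "poly [:c - 2 * a, b - 3, a, 1:] 2 < 0" "-2 < e" "e < 2"
    and pos: "\<forall>n\<in>{1..7}. beta_rem x n > 0"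
    and d: "beta_digit x 8 \<noteq> beta_digit x 1" "i \<in> {2..8}" "beta_digit x i \<noteq> beta_digit x 2"
    and fact: "[:1, a, b, c, b, a, 1:] * q = [:beta_digit x 1 - beta_digit x 8, - beta_digit x 7 - 1,
      - beta_digit x 6, - beta_digit x 5, - beta_digit x 4, - beta_digit x 3,
      - beta_digit x 2, - beta_digit x 1, 1:]"
  shows "x \<in> salem_numbers 6 \<inter> salem_parry_numbers 1 7 \<and> is_cofactor x q"
proof -
  have sx: "salem x" by (rule salem_sextic[OF par root x trace])
  note mp = min_poly_sextic(2)[OF par root]
  have "trunc_poly x 8 - trunc_poly x 1 = [:1, a, b, c, b, a, 1:] * q"
    unfolding fact trunc_poly_8 by (simp add: trunc_poly_Suc trunc_poly_0 one_pCons)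
  then have eq: "trunc_poly x 8 = [:1, a, b, c, b, a, 1:] * q + trunc_poly x 1" by (simp add: algebra_simps)
  have add: "map_poly of_int (p + q) = (map_poly of_int p + map_poly of_int q :: real poly)" for p q
    by (rule poly_eqI) (simp add: coeff_map_poly)
  have "beta_rem x 8 = poly (map_poly of_int (trunc_poly x 8)) x" by (simp only: poly_trunc_poly)
  also have "\<dots> = beta_rem x 1"
    unfolding eq add map_poly_of_int_mult poly_add poly_mult root poly_trunc_poly by simp
  finally have rem: "beta_rem x 8 = beta_rem x 1" .
  note parry = parry_1_7I[OF x rem pos d]
  have "is_cofactor x q"
    unfolding is_cofactor_def mp map_poly_of_int_mult[symmetric] map_poly_of_int_eq_iff
    using sx parry companion_poly_1_7[OF parry(2,3)] fact by simp
  moreover have "degree (min_poly x) = 6" unfolding mp by (simp add: degree_map_poly)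
  ultimately show ?thesis
    using sx parry by (simp add: salem_numbers_def salem_parry_numbers_def)
qed

section \<open>The three explicit Salem numbers\<close>

lemma cofactor_witness_zero:
  "\<exists>x \<in> salem_numbers 6 \<inter> salem_parry_numbers 1 7. is_cofactor x [:1, 0, 1:]"
proof -
  let ?M = "map_poly of_int [:1, -4, -2, 3, -2, -4, 1:] :: real poly"
  have M: "?M = [:1, -4, -2, 3, -2, -4, 1:]" by (simp add: map_poly_pCons)
  \<comment> \<open>Each greedy step widens the enclosure by a factor of roughly \<open>x\<close>;
    the initial precision is fine enough to decide all eight digits. The same holds for the other
    two witnesses.\<close>
  obtain x where x: "433683 / 100000 < x" "x < 433684 / 100000" "poly ?M x = 0"
    using poly_IVT_pos[of "433683 / 100000" "433684 / 100000" ?M] unfolding M by auto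
  note step = beta_step[OF less_imp_le[OF x(1)] less_imp_le[OF x(2)]]
  have d1: "beta_digit x 1 = 4" and r1: "33683/100000 \<le> beta_rem x 1" "beta_rem x 1 \<le> 33684/100000"
    using step[of "1" 0 "1" 1 4 "33683/100000" "33684/100000"] by (simp_all del: beta_rem.simps(2))
  have d2: "beta_digit x 2 = 1" and r2: "46077/100000 \<le> beta_rem x 2" "beta_rem x 2 \<le> 46083/100000"
    using step[of "33683/100000" 1 "33684/100000" 2 1 "46077/100000" "46083/100000"] r1 by (simp_all del: beta_rem.simps(2))
  have d3: "beta_digit x 3 = 1" and r3: "99828/100000 \<le> beta_rem x 3" "beta_rem x 3 \<le> 99855/100000"
    using step[of "46077/100000" 2 "46083/100000" 3 1 "99828/100000" "99855/100000"] r2 by (simp_all del: beta_rem.simps(2))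
  have d4: "beta_digit x 4 = 4" and r4: "32937/100000 \<le> beta_rem x 4" "beta_rem x 4 \<le> 33056/100000"
    using step[of "99828/100000" 3 "99855/100000" 4 4 "32937/100000" "33056/100000"] r3 by (simp_all del: beta_rem.simps(2))
  have d5: "beta_digit x 5 = 1" and r5: "42842/100000 \<le> beta_rem x 5" "beta_rem x 5 \<le> 43359/100000"
    using step[of "32937/100000" 4 "33056/100000" 5 1 "42842/100000" "43359/100000"] r4 by (simp_all del: beta_rem.simps(2))
  have d6: "beta_digit x 6 = 1" and r6: "85798/100000 \<le> beta_rem x 6" "beta_rem x 6 \<le> 88042/100000"
    using step[of "42842/100000" 5 "43359/100000" 6 1 "85798/100000" "88042/100000"] r5 by (simp_all del: beta_rem.simps(2))
  have d7: "beta_digit x 7 = 3" and r7: "72091/100000 \<le> beta_rem x 7" "beta_rem x 7 \<le> 81825/100000"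
    using step[of "85798/100000" 6 "88042/100000" 7 3 "72091/100000" "81825/100000"] r6 by (simp_all del: beta_rem.simps(2))
  have d8: "beta_digit x 8 = 3" and r8: "12646/100000 \<le> beta_rem x 8" "beta_rem x 8 \<le> 54862/100000"
    using step[of "72091/100000" 7 "81825/100000" 8 3 "12646/100000" "54862/100000"] r7 by (simp_all del: beta_rem.simps(2))
  have "x \<in> salem_numbers 6 \<inter> salem_parry_numbers 1 7 \<and> is_cofactor x [:1, 0, 1:]"
  \<comment> \<open>The trace polynomial is 11 at 0, and the digits from the second on are 1, 1, 4,
    1, 1, 3, 3, so the fourth digit differs from the second.\<close>
  proof (rule cofactor_witness[OF _ _ _ x(3), where e = "0" and i = 4])
    show "\<forall>n\<in>{1..7}. beta_rem x n > 0"
    proof -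
      have "{1..7} = {1, 2, 3, 4, 5, 6, 7::nat}" by auto
      moreover have "beta_rem x 1 > 0" "beta_rem x 2 > 0" "beta_rem x 3 > 0" "beta_rem x 4 > 0"
          "beta_rem x 5 > 0" "beta_rem x 6 > 0" "beta_rem x 7 > 0"
        using r1 r2 r3 r4 r5 r6 r7 by linarith+
      ultimately show ?thesis by (simp del: beta_rem.simps(2))
    qed
  qed (use x(1) in \<open>simp_all add: d1[unfolded One_nat_def] d2 d3 d4 d5 d6 d7 d8\<close>)
  then show ?thesis by blast
qed

lemma cofactor_witness_two:
  "\<exists>x \<in> salem_numbers 6 \<inter> salem_parry_numbers 1 7. is_cofactor x [:1, 2, 1:]"
proof -
  let ?M = "map_poly of_int [:1, -8, 10, -13, 10, -8, 1:] :: real poly"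
  have M: "?M = [:1, -8, 10, -13, 10, -8, 1:]" by (simp add: map_poly_pCons)
  obtain x where x: "6779422 / 1000000 < x" "x < 6779423 / 1000000" "poly ?M x = 0"
    using poly_IVT_pos[of "6779422 / 1000000" "6779423 / 1000000" ?M] unfolding M by auto
  note step = beta_step[OF less_imp_le[OF x(1)] less_imp_le[OF x(2)]]
  have d1: "beta_digit x 1 = 6" and r1: "779422/1000000 \<le> beta_rem x 1" "beta_rem x 1 \<le> 779423/1000000"
    using step[of "1" 0 "1" 1 6 "779422/1000000" "779423/1000000"] by (simp_all del: beta_rem.simps(2))
  have d2: "beta_digit x 2 = 5" and r2: "284030/1000000 \<le> beta_rem x 2" "beta_rem x 2 \<le> 284039/1000000"
    using step[of "779422/1000000" 1 "779423/1000000" 2 5 "284030/1000000" "284039/1000000"] r1 by (simp_all del: beta_rem.simps(2))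
  have d3: "beta_digit x 3 = 1" and r3: "925559/1000000 \<le> beta_rem x 3" "beta_rem x 3 \<le> 925621/1000000"
    using step[of "284030/1000000" 2 "284039/1000000" 3 1 "925559/1000000" "925621/1000000"] r2 by (simp_all del: beta_rem.simps(2))
  have d4: "beta_digit x 4 = 6" and r4: "274755/1000000 \<le> beta_rem x 4" "beta_rem x 4 \<le> 275177/1000000"
    using step[of "925559/1000000" 3 "925621/1000000" 4 6 "274755/1000000" "275177/1000000"] r3 by (simp_all del: beta_rem.simps(2))
  have d5: "beta_digit x 5 = 1" and r5: "862680/1000000 \<le> beta_rem x 5" "beta_rem x 5 \<le> 865542/1000000"
    using step[of "274755/1000000" 4 "275177/1000000" 5 1 "862680/1000000" "865542/1000000"] r4 by (simp_all del: beta_rem.simps(2))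
  have d6: "beta_digit x 6 = 5" and r6: "848471/1000000 \<le> beta_rem x 6" "beta_rem x 6 \<le> 867876/1000000"
    using step[of "862680/1000000" 5 "865542/1000000" 6 5 "848471/1000000" "867876/1000000"] r5 by (simp_all del: beta_rem.simps(2))
  have d7: "beta_digit x 7 = 5" and r7: "752142/1000000 \<le> beta_rem x 7" "beta_rem x 7 \<le> 883699/1000000"
    using step[of "848471/1000000" 6 "867876/1000000" 7 5 "752142/1000000" "883699/1000000"] r6 by (simp_all del: beta_rem.simps(2))
  have d8: "beta_digit x 8 = 5" and r8: "99088/1000000 \<le> beta_rem x 8" "beta_rem x 8 \<le> 990970/1000000"
    using step[of "752142/1000000" 7 "883699/1000000" 8 5 "99088/1000000" "990970/1000000"] r7 by (simp_all del: beta_rem.simps(2))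
  have "x \<in> salem_numbers 6 \<inter> salem_parry_numbers 1 7 \<and> is_cofactor x [:1, 2, 1:]"
  \<comment> \<open>The trace polynomial is 3 at 0; the third digit is 1, the second 5.\<close>
  proof (rule cofactor_witness[OF _ _ _ x(3), where e = "0" and i = 3])
    show "\<forall>n\<in>{1..7}. beta_rem x n > 0"
    proof -
      have "{1..7} = {1, 2, 3, 4, 5, 6, 7::nat}" by auto
      moreover have "beta_rem x 1 > 0" "beta_rem x 2 > 0" "beta_rem x 3 > 0" "beta_rem x 4 > 0"
          "beta_rem x 5 > 0" "beta_rem x 6 > 0" "beta_rem x 7 > 0"
        using r1 r2 r3 r4 r5 r6 r7 by linarith+
      ultimately show ?thesis by (simp del: beta_rem.simps(2))
    qed
  qed (use x(1) in \<open>simp_all add: d1[unfolded One_nat_def] d2 d3 d4 d5 d6 d7 d8\<close>)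
  then show ?thesis by blast
qed

lemma cofactor_witness_minus_one:
  "\<exists>x \<in> salem_numbers 6 \<inter> salem_parry_numbers 1 7. is_cofactor x [:1, -1, 1:]"
proof -
  let ?M = "map_poly of_int [:1, 0, -2, -3, -2, 0, 1:] :: real poly"
  have M: "?M = [:1, 0, -2, -3, -2, 0, 1:]" by (simp add: map_poly_pCons)
  obtain x where x: "19877 / 10000 < x" "x < 19878 / 10000" "poly ?M x = 0"
    using poly_IVT_pos[of "19877 / 10000" "19878 / 10000" ?M] unfolding M by auto
  note step = beta_step[OF less_imp_le[OF x(1)] less_imp_le[OF x(2)]]
  have d1: "beta_digit x 1 = 1" and r1: "9877/10000 \<le> beta_rem x 1" "beta_rem x 1 \<le> 9878/10000"
    using step[of "1" 0 "1" 1 1 "9877/10000" "9878/10000"] by (simp_all del: beta_rem.simps(2))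
  have d2: "beta_digit x 2 = 1" and r2: "9632/10000 \<le> beta_rem x 2" "beta_rem x 2 \<le> 9636/10000"
    using step[of "9877/10000" 1 "9878/10000" 2 1 "9632/10000" "9636/10000"] r1 by (simp_all del: beta_rem.simps(2))
  have d3: "beta_digit x 3 = 1" and r3: "9145/10000 \<le> beta_rem x 3" "beta_rem x 3 \<le> 9155/10000"
    using step[of "9632/10000" 2 "9636/10000" 3 1 "9145/10000" "9155/10000"] r2 by (simp_all del: beta_rem.simps(2))
  have d4: "beta_digit x 4 = 1" and r4: "8177/10000 \<le> beta_rem x 4" "beta_rem x 4 \<le> 8199/10000"
    using step[of "9145/10000" 3 "9155/10000" 4 1 "8177/10000" "8199/10000"] r3 by (simp_all del: beta_rem.simps(2))
  have d5: "beta_digit x 5 = 1" and r5: "6253/10000 \<le> beta_rem x 5" "beta_rem x 5 \<le> 6298/10000"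
    using step[of "8177/10000" 4 "8199/10000" 5 1 "6253/10000" "6298/10000"] r4 by (simp_all del: beta_rem.simps(2))
  have d6: "beta_digit x 6 = 1" and r6: "2429/10000 \<le> beta_rem x 6" "beta_rem x 6 \<le> 2520/10000"
    using step[of "6253/10000" 5 "6298/10000" 6 1 "2429/10000" "2520/10000"] r5 by (simp_all del: beta_rem.simps(2))
  have d7: "beta_digit x 7 = 0" and r7: "4828/10000 \<le> beta_rem x 7" "beta_rem x 7 \<le> 5010/10000"
    using step[of "2429/10000" 6 "2520/10000" 7 0 "4828/10000" "5010/10000"] r6 by (simp_all del: beta_rem.simps(2))
  have d8: "beta_digit x 8 = 0" and r8: "9596/10000 \<le> beta_rem x 8" "beta_rem x 8 \<le> 9959/10000"
    using step[of "4828/10000" 7 "5010/10000" 8 0 "9596/10000" "9959/10000"] r7 by (simp_all del: beta_rem.simps(2))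
  have "x \<in> salem_numbers 6 \<inter> salem_parry_numbers 1 7 \<and> is_cofactor x [:1, -1, 1:]"
  \<comment> \<open>The trace polynomial \<open>y^3 - 5 * y - 3\<close> is negative at 0 but equals
    1 at -1. The first six digits are 1, so the seventh is the first to differ.\<close>
  proof (rule cofactor_witness[OF _ _ _ x(3), where e = "-1" and i = 7])
    show "\<forall>n\<in>{1..7}. beta_rem x n > 0"
    proof -
      have "{1..7} = {1, 2, 3, 4, 5, 6, 7::nat}" by auto
      moreover have "beta_rem x 1 > 0" "beta_rem x 2 > 0" "beta_rem x 3 > 0" "beta_rem x 4 > 0"
          "beta_rem x 5 > 0" "beta_rem x 6 > 0" "beta_rem x 7 > 0"
        using r1 r2 r3 r4 r5 r6 r7 by linarith+
      ultimately show ?thesis by (simp del: beta_rem.simps(2))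
    qed
  qed (use x(1) in \<open>simp_all add: d1[unfolded One_nat_def] d2 d3 d4 d5 d6 d7 d8\<close>)
  then show ?thesis by blast
qed

theorem proposition3p4:
  shows "minimal_cofactor_set 6 1 7 = {[:1, -1, 1:], [:1, 0, 1:], [:1, 2, 1:]}"
proof (rule minimal_cofactor_setI)
  show "q \<in> {[:1, -1, 1:], [:1, 0, 1:], [:1, 2, 1:]}"
    if "x \<in> salem_numbers 6 \<inter> salem_parry_numbers 1 7" "is_cofactor x q" for x q
    using that by (rule cofactor_classification)
  show "\<exists>x \<in> salem_numbers 6 \<inter> salem_parry_numbers 1 7. is_cofactor x q"
    if "q \<in> {[:1, -1, 1:], [:1, 0, 1:], [:1, 2, 1:]}" for q
    using that cofactor_witness_zero cofactor_witness_two cofactor_witness_minus_one by blast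
qed auto

end
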